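(* There exists an absolute constant $C$ such that for every $n\ge 1$ and every $p$ with $0\le p\le 1-\frac{10^5}{n}$, if $G\sim G(n,p)$ then $$\mathbb{P}(G\text{ is even-non-decomposable})\le \frac{C}{n^2}.$$
   Context: $G(n,p)$ is the binomial random graph on $n$ labelled vertices in which each pair is an edge independently with probability $p$. A graph $H$ is even-decomposable if there is a sequence $V(H)=V_0\supset V_1\supset\cdots\supset V_k=\emptyset$ such that for each $0\le i\le k-1$, the induced subgraph $H[V_i]$ has an even number of edges and $V_i\setminus V_{i+1}$ is an independent set in $H$. A graph is even-non-decomposable if it has an even number of edges but is not even-decomposable. *)

theory Defs
  imports Complex_Main
begin

(* A simple graph is given by its edge set E (a set of 2-element vertex sets). *)

definition induced_edges :: "'a set set \<Rightarrow> 'a set \<Rightarrow> 'a set set" where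
  "induced_edges E V = {e \<in> E. e \<subseteq> V}"

definition independent :: "'a set set \<Rightarrow> 'a set \<Rightarrow> bool" where
  "independent E I \<longleftrightarrow> (\<forall>e\<in>E. \<not> e \<subseteq> I)"

(* even_dec E V: the induced graph on V is even-decomposable, i.e. there is a chain
   V = V_0 \<supset> V_1 \<supset> ... \<supset> V_k = {} with each H[V_i] (i<k) having an even number
   of edges and each V_i - V_(i+1) independent. *)
inductive even_dec :: "'a set set \<Rightarrow> 'a set \<Rightarrow> bool" for E where
  empty: "even_dec E {}"
| step: "\<lbrakk> even (card (induced_edges E V)); I \<subseteq> V; I \<noteq> {}; independent E I;
           even_dec E (V - I) \<rbrakk> \<Longrightarrow> even_dec E V"

definition even_non_dec :: "'a set set \<Rightarrow> 'a set \<Rightarrow> bool" where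
  "even_non_dec E V \<longleftrightarrow> even (card (induced_edges E V)) \<and> \<not> even_dec E V"

definition all_pairs :: "nat \<Rightarrow> nat set set" where
  "all_pairs n = {e. e \<subseteq> {0..<n} \<and> card e = 2}"

definition gnp_prob :: "nat \<Rightarrow> real \<Rightarrow> (nat set set \<Rightarrow> bool) \<Rightarrow> real" where
  "gnp_prob n p P = (\<Sum>E\<in>Pow (all_pairs n).
      if P E then p ^ card E * (1 - p) ^ (card (all_pairs n) - card E) else 0)"

end

theory Submission
  imports Defs
begin

text \<open>
  Let \<open>W\<close> induce an even number of edges. Deleting from \<open>W\<close> one vertex of even degree, or two
  non-adjacent vertices of odd degree, keeps the number of edges even. Hence greedy deletion gets
  stuck only at a clique all of whose vertices have odd degree, and it can be confined to any
  prescribed part of the vertex set.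

  The remaining clique \<open>K\<close> is destroyed by absorbers, small induced subgraphs \<open>T\<close> such that
  \<open>K \<union> T\<close> can be reduced to fewer than \<open>card K\<close> vertices whatever the adjacencies to \<open>K\<close> and the
  degree parities are. For sparse graphs an induced matching absorbs, for dense graphs the complement
  of an induced union of paths with three vertices. A graph with more disjoint absorbers than the
  size of its largest clique is therefore even-decomposable.

  If \<open>p < 10^5 / n\<close>, a non-decomposable graph contains \<open>K\<^sub>4\<close>, which has probability \<open>O(n^-2)\<close>. If \<open>p\<close>
  or \<open>1 - p\<close> lies between \<open>10^5 / n\<close> and \<open>1 / 2000\<close>, the edges (or non-edges) have small maximal
  degree and meet all pairs of large disjoint sets, which gives linearly many disjoint
  absorbers by a greedy choice. For the other \<open>p\<close> both edges and non-edges are dense between all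
  pairs of large sets, so every graph on 12 vertices embeds into every large set.
\<close>

section \<open>Reductions preserving the parity of the number of edges\<close>

text \<open>A clique offers only single vertices as independent sets, so deletion cannot be
  continued from inside it: K4 has six edges, each of its triangles has three, and it is itself
  even-non-decomposable. Help must come from outside, and it must not depend on how it is attached,
  because the clique is produced by the deletions and can depend on the whole graph. A move sees
  only the adjacencies and degree parities of the few vertices involved, so a small gadget has
  finitely many configurations and a worst-case check is possible. A spent absorber leaves some
  vertices of its own behind. The number of remaining vertices therefore falls only while it exceeds
  a bound \<open>b\<close> (2 for matchings, 9 for joined cherries), and one last absorber has to
  clear the rest. The constant 10^5 balances a union bound: at most 4^n pairs of sets of size about
  n/250 against a factor exp (- 10^5/n * (n/250)^2) = exp (- 8n/5), where 8/5 exceeds the natural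
  logarithm of 4.\<close>

locale simple_graph =
  fixes E :: "'a set set"
  assumes card_edge: "e \<in> E \<Longrightarrow> card e = 2"
begin

definition nb :: "'a set \<Rightarrow> 'a \<Rightarrow> 'a set" where
  "nb W v = {u \<in> W. {u, v} \<in> E}"

definition odd_deg :: "'a set \<Rightarrow> 'a \<Rightarrow> bool" where
  "odd_deg W v \<longleftrightarrow> odd (card (nb W v))"

definition even_edges :: "'a set \<Rightarrow> bool" where
  "even_edges W \<longleftrightarrow> even (card (induced_edges E W))"

text \<open>Along a deletion evenness travels forwards and decomposability backwards. Bundling both
  under the guard \<open>even_edges W\<close> makes the relation transitive, so moves compose
  without further parity bookkeeping.\<close>

definition red :: "'a set \<Rightarrow> 'a set \<Rightarrow> bool" where
  "red W W' \<longleftrightarrow> (even_edges W \<longrightarrow> even_edges W' \<and> (even_dec E W' \<longrightarrow> even_dec E W))"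

definition clique :: "'a set \<Rightarrow> bool" where
  "clique K \<longleftrightarrow> (\<forall>u\<in>K. \<forall>v\<in>K. u \<noteq> v \<longrightarrow> {u, v} \<in> E)"

lemma no_loop: "{v, v} \<notin> E"
  using card_edge[of "{v}"] by auto

lemma edge_neq: "{u, v} \<in> E \<Longrightarrow> u \<noteq> v"
  using no_loop by auto

lemma clique_subset: "clique K \<Longrightarrow> L \<subseteq> K \<Longrightarrow> clique L"
  unfolding clique_def by blast

lemma nb_subset: "nb W v \<subseteq> W"
  unfolding nb_def by auto

lemma finite_induced_edges: "finite W \<Longrightarrow> finite (induced_edges E W)"
  unfolding induced_edges_def by (rule finite_subset[of _ "Pow W"]) auto

lemma card_induced_edges_remove:
  assumes "finite W" "v \<in> W"
  shows "card (induced_edges E W) = card (induced_edges E (W - {v})) + card (nb W v)"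
proof -
  let ?f = "\<lambda>u. {u, v}"
  have eq: "induced_edges E W = induced_edges E (W - {v}) \<union> ?f ` nb W v" (is "?L = ?R")
  proof
    show "?L \<subseteq> ?R"
    proof
      fix e assume e: "e \<in> ?L"
      then have "e \<in> E" "e \<subseteq> W" by (auto simp: induced_edges_def)
      obtain x y where xy: "e = {x, y}" using card_edge[OF \<open>e \<in> E\<close>] by (auto simp: card_2_iff)
      show "e \<in> ?R"
      proof (cases "v \<in> e")
        case True
        then have "e \<in> ?f ` nb W v"
          using xy \<open>e \<in> E\<close> \<open>e \<subseteq> W\<close> by (auto simp: nb_def insert_commute)
        then show ?thesis by auto
      next
        case False
        then show ?thesis using \<open>e \<in> E\<close> \<open>e \<subseteq> W\<close> by (auto simp: induced_edges_def)
      qed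
    qed
    show "?R \<subseteq> ?L" using assms by (auto simp: induced_edges_def nb_def)
  qed
  have inj: "inj_on ?f (nb W v)" by (rule inj_onI) (auto simp: doubleton_eq_iff)
  have fin: "finite (nb W v)" using assms(1) nb_subset finite_subset by blast
  have disj: "induced_edges E (W - {v}) \<inter> ?f ` nb W v = {}"
    by (auto simp: induced_edges_def)
  show ?thesis unfolding eq
    by (subst card_Un_disjoint)
      (use assms fin disj inj in \<open>auto simp: finite_induced_edges card_image\<close>)
qed

text \<open>The case \<open>v = u\<close> is included, because there are no loops; parities can thus
  be updated without side conditions.\<close>

lemma odd_deg_remove:
  assumes "finite W" "u \<in> W"
  shows "odd_deg (W - {u}) v \<longleftrightarrow> odd_deg W v \<noteq> ({u, v} \<in> E)"
proof -
  have fin: "finite (nb W v)" using assms(1) nb_subset finite_subset by blast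
  have "nb (W - {u}) v = nb W v - {u}" by (auto simp: nb_def)
  moreover have "u \<in> nb W v \<longleftrightarrow> {u, v} \<in> E" using assms by (auto simp: nb_def)
  moreover have "u \<in> nb W v \<Longrightarrow> card (nb W v) = Suc (card (nb W v - {u}))"
    using fin card_Suc_Diff1[of "nb W v" u] by metis
  ultimately show ?thesis unfolding odd_deg_def by (cases "{u, v} \<in> E") simp_all
qed

lemma even_edges_remove:
  assumes "finite W" "v \<in> W"
  shows "even_edges (W - {v}) \<longleftrightarrow> even_edges W \<noteq> odd_deg W v"
  using card_induced_edges_remove[OF assms] unfolding even_edges_def odd_deg_def by auto

lemma red_refl: "red W W"
  unfolding red_def by simp

lemma red_trans [trans]: "red U V \<Longrightarrow> red V W \<Longrightarrow> red U W"
  unfolding red_def by blast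

lemma red_independent:
  assumes "I \<subseteq> W" "I \<noteq> {}" "independent E I" "even_edges (W - I) = even_edges W"
  shows "red W (W - I)"
  using assms even_dec.step[of E W I] unfolding red_def even_edges_def by auto

lemma red_even:
  assumes "finite W" "v \<in> W" "\<not> odd_deg W v"
  shows "red W (W - {v})"
proof (rule red_independent)
  show "independent E {v}"
    unfolding independent_def
  proof (intro ballI notI)
    fix e assume "e \<in> E" "e \<subseteq> {v}"
    then have "card e \<le> 1" using card_mono[of "{v}" e] by simp
    then show False using card_edge[OF \<open>e \<in> E\<close>] by simp
  qed
qed (use assms even_edges_remove[OF assms(1,2)] in auto)

lemma red_odd_pair:
  assumes "finite W" "u \<in> W" "v \<in> W" "u \<noteq> v" "odd_deg W u" "odd_deg W v" "{u, v} \<notin> E"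
  shows "red W (W - {u} - {v})"
proof -
  have "red W (W - {u, v})"
  proof (rule red_independent)
    show "independent E {u, v}" unfolding independent_def
    proof (intro ballI notI)
      fix e assume "e \<in> E" "e \<subseteq> {u, v}"
      then have "e = {u, v}" using card_edge[OF \<open>e \<in> E\<close>] assms(4)
        by (intro card_subset_eq) auto
      then show False using \<open>e \<in> E\<close> assms(7) by simp
    qed
    have "even_edges (W - {u} - {v}) \<longleftrightarrow> even_edges W"
      using assms even_edges_remove[of W u] even_edges_remove[of "W - {u}" v]
        odd_deg_remove[of W u v] by auto
    then show "even_edges (W - {u, v}) = even_edges W"
      by (metis Diff_insert2)
  qed (use assms in auto)
  then show ?thesis by (metis Diff_insert2)
qed

text \<open>Parities are measured in all of \<open>U \<union> R\<close>, but only vertices of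
  \<open>U\<close> are deleted. Later \<open>R\<close> holds the absorbers, which have to stay
  intact at this stage.\<close>

lemma reduce_to_clique:
  assumes "finite U" "finite R" "U \<inter> R = {}"
  shows "\<exists>K\<subseteq>U. clique K \<and> (\<forall>k\<in>K. odd_deg (K \<union> R) k) \<and> red (U \<union> R) (K \<union> R)"
  using assms
proof (induction U rule: finite_psubset_induct)
  case (psubset U)
  have step: ?case if V: "V \<subset> U" "red (U \<union> R) (V \<union> R)" for V
  proof -
    have "V \<inter> R = {}" using V(1) psubset.prems by auto
    then obtain K where "K \<subseteq> V" "clique K" "\<forall>k\<in>K. odd_deg (K \<union> R) k"
      "red (V \<union> R) (K \<union> R)"
      using psubset.IH[OF V(1)] psubset.prems by blast
    then show ?thesis using V by (intro exI[of _ K]) (auto intro: red_trans)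
  qed
  show ?case
  proof (cases "\<exists>v\<in>U. \<not> odd_deg (U \<union> R) v")
    case True
    then obtain v where v: "v \<in> U" "\<not> odd_deg (U \<union> R) v" by blast
    have "red (U \<union> R) (U \<union> R - {v})" using v psubset by (intro red_even) auto
    moreover have "U \<union> R - {v} = (U - {v}) \<union> R" using v psubset.prems by auto
    ultimately show ?thesis using step[of "U - {v}"] v by auto
  next
    case odd: False
    show ?thesis
    proof (cases "clique U")
      case True
      then show ?thesis using odd red_refl by blast
    next
      case False
      then obtain u v where uv: "u \<in> U" "v \<in> U" "u \<noteq> v" "{u, v} \<notin> E"
        unfolding clique_def by blast
      have "red (U \<union> R) (U \<union> R - {u} - {v})" using uv odd psubset by (intro red_odd_pair) auto
      moreover have "U \<union> R - {u} - {v} = (U - {u, v}) \<union> R" using uv psubset.prems by auto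
      ultimately show ?thesis using step[of "U - {u, v}"] uv by auto
    qed
  qed
qed

text \<open>Odd degrees force a clique to have an even number of vertices, and two vertices span a
  single edge. Four is the first size at which a clique can be stuck.\<close>

lemma even_edges_clique_le3:
  assumes "finite K" "clique K" "card K \<le> 3" "even_edges K" "\<And>k. k \<in> K \<Longrightarrow> odd_deg K k"
  shows "K = {}"
proof (rule ccontr)
  assume "K \<noteq> {}"
  then obtain k where k: "k \<in> K" by blast
  have nb: "nb W v = W - {v}" if "W \<subseteq> K" "v \<in> K" for W v
    using that assms(2) no_loop unfolding nb_def clique_def by auto
  have "odd (card K - 1)"
    using assms(5)[OF k] nb[of K k] k assms(1) by (simp add: odd_deg_def card_Diff_singleton)
  with assms(3) have c: "card K = 2" by (cases "card K = 0 \<or> card K = 1 \<or> card K = 3") auto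
  then obtain x y where xy: "K = {x, y}" "x \<noteq> y" by (auto simp: card_2_iff)
  have "\<not> odd_deg (K - {x}) y"
    using nb[of "K - {x}" y] xy unfolding odd_deg_def by auto
  then have "even_edges (K - {x} - {y})  \<noteq> even_edges K"
    using even_edges_remove[of K x] even_edges_remove[of "K - {x}" y] assms xy by auto
  moreover have "K - {x} - {y} = {}" using xy by auto
  moreover have "induced_edges E {} = {}" using card_edge by (force simp: induced_edges_def)
  ultimately show False using assms(4) by (simp add: even_edges_def)
qed

lemma even_dec_of_small_cliques:
  assumes "finite W" "even_edges W" "\<And>K. K \<subseteq> W \<Longrightarrow> clique K \<Longrightarrow> card K \<le> 3"
  shows "even_dec E W"
proof -
  obtain K where K: "K \<subseteq> W" "clique K" "\<forall>k\<in>K. odd_deg K k" "red W K"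
    using reduce_to_clique[of W "{}"] assms(1) by auto
  have "K = {}"
    using K assms finite_subset[OF K(1)] by (intro even_edges_clique_le3) (auto simp: red_def)
  then show ?thesis using K(4) assms(2) even_dec.empty by (auto simp: red_def)
qed

end

section \<open>Deletion games on small vertex sets\<close>

text \<open>
  \<open>st\<close> lists the vertices still present with their degree parities (\<open>True\<close> for odd) in the whole
  remaining graph. \<open>elim n A Q st\<close> says that at most \<open>n\<close> deletions lead to a list satisfying \<open>Q\<close>; this
  turns statements about all adjacencies and parities into finite checks by evaluation.
\<close>
primrec elim :: "nat \<Rightarrow> ('i \<Rightarrow> 'i \<Rightarrow> bool) \<Rightarrow> ('i list \<Rightarrow> bool) \<Rightarrow> ('i \<times> bool) list \<Rightarrow> bool" where
  "elim 0 A Q st \<longleftrightarrow> Q (map fst st)"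
| "elim (Suc n) A Q st \<longleftrightarrow> Q (map fst st) \<or>
     list_ex (\<lambda>(x, d).
       (\<not> d \<and> elim n A Q (map (\<lambda>(z, c). (z, c \<noteq> A x z)) (filter (\<lambda>(z, c). z \<noteq> x) st))) \<or>
       (d \<and> list_ex (\<lambda>(y, e). e \<and> x \<noteq> y \<and> \<not> A x y \<and>
          elim n A Q (map (\<lambda>(z, c). (z, c \<noteq> (A x z \<noteq> A y z)))
            (filter (\<lambda>(z, c). z \<noteq> x \<and> z \<noteq> y) st))) st)) st"

text \<open>\<open>Ka\<close> stands for a vertex to be absorbed, the other names for the vertices of at most two gadgets.\<close>
datatype loc = Ka | A0 | B0 | C0 | A1 | B1 | C1

text \<open>Quantification over \<open>bool\<close> is spelled out as a list so that
  \<open>code_simp\<close> can evaluate it; \<open>all_bool_iff\<close> leads back to ordinary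
  quantifiers.\<close>

abbreviation (input) all_bool :: "(bool \<Rightarrow> bool) \<Rightarrow> bool" where
  "all_bool P \<equiv> list_all P [True, False]"

lemma all_bool_iff: "all_bool P \<longleftrightarrow> (\<forall>b. P b)"
  by (auto, metis (full_types))

definition matching_adj :: "bool \<Rightarrow> bool \<Rightarrow> bool \<Rightarrow> bool \<Rightarrow> loc \<Rightarrow> loc \<Rightarrow> bool" where
  "matching_adj a b c d x y = (case x of
     Ka \<Rightarrow> (case y of A0 \<Rightarrow> a | B0 \<Rightarrow> b | A1 \<Rightarrow> c | B1 \<Rightarrow> d | _ \<Rightarrow> False)
   | A0 \<Rightarrow> (case y of Ka \<Rightarrow> a | B0 \<Rightarrow> True | _ \<Rightarrow> False)
   | B0 \<Rightarrow> (case y of Ka \<Rightarrow> b | A0 \<Rightarrow> True | _ \<Rightarrow> False)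
   | A1 \<Rightarrow> (case y of Ka \<Rightarrow> c | B1 \<Rightarrow> True | _ \<Rightarrow> False)
   | B1 \<Rightarrow> (case y of Ka \<Rightarrow> d | A1 \<Rightarrow> True | _ \<Rightarrow> False)
   | _ \<Rightarrow> False)"

text \<open>The 256 cases are the adjacencies of \<open>Ka\<close> to the two edges and the parities
  of their ends. \<open>Ka\<close> may be taken odd, as an even vertex is deleted at once. Five
  moves cannot be exceeded, since each one removes at least one of the five vertices.\<close>

lemma elim_matching:
  "all_bool (\<lambda>a. all_bool (\<lambda>b. all_bool (\<lambda>c. all_bool (\<lambda>d.
   all_bool (\<lambda>a'. all_bool (\<lambda>b'. all_bool (\<lambda>c'. all_bool (\<lambda>d'.
     elim 5 (matching_adj a b c d) (\<lambda>l. \<not> List.member l Ka)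
       [(Ka, True), (A0, a'), (B0, b'), (A1, c'), (B1, d')]))))))))"
  by code_simp

text \<open>Inside a cherry only the two outer vertices are adjacent, so its complement is a path
  with the \<open>B\<close> vertex in the middle; different cherries are completely joined. The same
  table serves a single cherry, the last three bits then being dummies.\<close>

definition cherries_adj :: "bool \<Rightarrow> bool \<Rightarrow> bool \<Rightarrow> bool \<Rightarrow> bool \<Rightarrow> bool \<Rightarrow> loc \<Rightarrow> loc \<Rightarrow> bool" where
  "cherries_adj a b c d e f x y = (case x of
     Ka \<Rightarrow> (case y of Ka \<Rightarrow> False | A0 \<Rightarrow> a | B0 \<Rightarrow> b | C0 \<Rightarrow> c | A1 \<Rightarrow> d | B1 \<Rightarrow> e | C1 \<Rightarrow> f)
   | A0 \<Rightarrow> (case y of Ka \<Rightarrow> a | A0 \<Rightarrow> False | B0 \<Rightarrow> False | _ \<Rightarrow> True)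
   | B0 \<Rightarrow> (case y of Ka \<Rightarrow> b | A0 \<Rightarrow> False | B0 \<Rightarrow> False | C0 \<Rightarrow> False | _ \<Rightarrow> True)
   | C0 \<Rightarrow> (case y of Ka \<Rightarrow> c | B0 \<Rightarrow> False | C0 \<Rightarrow> False | _ \<Rightarrow> True)
   | A1 \<Rightarrow> (case y of Ka \<Rightarrow> d | A1 \<Rightarrow> False | B1 \<Rightarrow> False | _ \<Rightarrow> True)
   | B1 \<Rightarrow> (case y of Ka \<Rightarrow> e | A1 \<Rightarrow> False | B1 \<Rightarrow> False | C1 \<Rightarrow> False | _ \<Rightarrow> True)
   | C1 \<Rightarrow> (case y of Ka \<Rightarrow> f | B1 \<Rightarrow> False | C1 \<Rightarrow> False | _ \<Rightarrow> True))"

text \<open>Deleting all four vertices removes as many edges as their degree sum minus the number of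
  edges among them. Modulo 2 this is the sum of the six bits, since the odd degree of
  \<open>Ka\<close> cancels against the edge from \<open>A0\<close> to \<open>C0\<close>. Complete
  annihilation therefore requires an even sum; an odd sum leaves one cherry vertex over.\<close>

lemma elim_cherry:
  "all_bool (\<lambda>a. all_bool (\<lambda>b. all_bool (\<lambda>c. all_bool (\<lambda>a'. all_bool (\<lambda>b'. all_bool (\<lambda>c'.
     (a \<and> \<not> b \<and> c \<and> a' \<and> \<not> b' \<and> c') \<or>
     elim 4 (cherries_adj a b c False False False)
       (\<lambda>l. l = [] \<or> (a \<noteq> (b \<noteq> (c \<noteq> (a' \<noteq> (b' \<noteq> c'))))) \<and> (l = [A0] \<or> l = [B0] \<or> l = [C0]))
       [(Ka, True), (A0, a'), (B0, b'), (C0, c')]))))))"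
  by code_simp

text \<open>With three adjacencies present, the six bits have an even sum exactly if the three
  parities have an odd one, and adjacency to \<open>B0\<close> rules out the exceptional
  pattern.\<close>

lemma elim_joined_cherry:
  "all_bool (\<lambda>a'. all_bool (\<lambda>b'. all_bool (\<lambda>c'. (a' \<noteq> (b' \<noteq> c')) \<longrightarrow>
     elim 4 (cherries_adj True True True False False False) (\<lambda>l. l = [])
       [(Ka, True), (A0, a'), (B0, b'), (C0, c')])))"
  by code_simp

text \<open>Two joined cherries manage together what neither can do alone. Nothing is quantified,
  because the exceptional pattern fixes all adjacencies to \<open>Ka\<close> and all
  parities.\<close>

lemma elim_special_cherries:
  "elim 7 (cherries_adj True False True True False True) (\<lambda>l. l = [])
     [(Ka, True), (A0, True), (B0, False), (C0, True), (A1, True), (B1, False), (C1, True)]"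
  by code_simp

section \<open>Soundness of the games, and absorption of a single vertex\<close>

context simple_graph
begin

text \<open>A deletion flips the parity of another vertex exactly if the two are adjacent, so the
  list stays accurate whatever \<open>W\<close> contains outside the image of \<open>f\<close>. The
  witness \<open>l\<close> lists the surviving vertices.\<close>

lemma elim_sound:
  assumes "elim n A Q st" "finite W" "distinct (map fst st)" "inj_on f (fst ` set st)"
    "f ` fst ` set st \<subseteq> W"
    "\<And>x d. (x, d) \<in> set st \<Longrightarrow> d = odd_deg W (f x)"
    "\<And>x y. x \<in> fst ` set st \<Longrightarrow> y \<in> fst ` set st \<Longrightarrow> x \<noteq> y \<Longrightarrow> A x y = ({f x, f y} \<in> E)"
  shows "\<exists>l. Q l \<and> set l \<subseteq> fst ` set st \<and> red W (W - f ` (fst ` set st - set l))"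
  using assms
proof (induction n arbitrary: st W)
  case 0
  then show ?case by (intro exI[of _ "map fst st"]) (auto intro: red_refl)
next
  case (Suc n)
  note adj = Suc.prems(7) and par = Suc.prems(6) and inj = Suc.prems(4)
  consider (stop) "Q (map fst st)"
    | (single) x where "(x, False) \<in> set st"
        "elim n A Q (map (\<lambda>(z, c). (z, c \<noteq> A x z)) (filter (\<lambda>(z, c). z \<noteq> x) st))"
    | (pair) x y where "(x, True) \<in> set st" "(y, True) \<in> set st" "x \<noteq> y" "\<not> A x y"
        "elim n A Q (map (\<lambda>(z, c). (z, c \<noteq> (A x z \<noteq> A y z)))
          (filter (\<lambda>(z, c). z \<noteq> x \<and> z \<noteq> y) st))"
    using Suc.prems(1) by (auto simp: list_ex_iff)
  then show ?case
  proof cases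
    case stop
    then show ?thesis by (intro exI[of _ "map fst st"]) (auto intro: red_refl)
  next
    case single
    define st' where "st' = map (\<lambda>(z, c). (z, c \<noteq> A x z)) (filter (\<lambda>(z, c). z \<noteq> x) st)"
    have x: "x \<in> fst ` set st" using single(1) by force
    have fx: "f x \<in> W" using x Suc.prems(5) by auto
    have dom: "fst ` set st' = fst ` set st - {x}" unfolding st'_def by force
    have "\<exists>l. Q l \<and> set l \<subseteq> fst ` set st' \<and> red (W - {f x}) (W - {f x} - f ` (fst ` set st' - set l))"
    proof (rule Suc.IH)
      show "elim n A Q st'" using single(2) unfolding st'_def .
      show "distinct (map fst st')" using Suc.prems(3) unfolding st'_def
        by (auto simp: distinct_map comp_def case_prod_beta inj_on_def)
      show "inj_on f (fst ` set st')" using inj unfolding dom by (rule inj_on_subset) auto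
      show "f ` fst ` set st' \<subseteq> W - {f x}" using Suc.prems(5) inj x unfolding dom
        by (auto simp: inj_on_def)
      show "d = odd_deg (W - {f x}) (f z)" if "(z, d) \<in> set st'" for z d
      proof -
        from that obtain c where c: "(z, c) \<in> set st" "z \<noteq> x" "d = (c \<noteq> A x z)"
          unfolding st'_def by auto
        then show ?thesis
          using par[OF c(1)] adj[of x z] x odd_deg_remove[OF Suc.prems(2) fx, of "f z"] by force
      qed
    qed (use Suc.prems(2) adj dom in auto)
    then obtain l where l: "Q l" "set l \<subseteq> fst ` set st'"
      "red (W - {f x}) (W - {f x} - f ` (fst ` set st' - set l))" by blast
    have r1: "red W (W - {f x})"
      using par[OF single(1)] by (intro red_even Suc.prems(2) fx) simp
    have eq: "W - {f x} - f ` (fst ` set st' - set l) = W - f ` (fst ` set st - set l)"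
    proof -
      have "fst ` set st - set l = insert x (fst ` set st' - set l)"
        using l(2) x unfolding dom by blast
      then show ?thesis by (simp only: image_insert) blast
    qed
    have "red W (W - f ` (fst ` set st - set l))" using red_trans[OF r1 l(3)] unfolding eq .
    moreover have "set l \<subseteq> fst ` set st" using l(2) unfolding dom by blast
    ultimately show ?thesis using l(1) by (intro exI[of _ l] conjI)
  next
    case pair
    define st' where "st' = map (\<lambda>(z, c). (z, c \<noteq> (A x z \<noteq> A y z)))
          (filter (\<lambda>(z, c). z \<noteq> x \<and> z \<noteq> y) st)"
    have x: "x \<in> fst ` set st" and y: "y \<in> fst ` set st" using pair(1,2) by force+
    have fx: "f x \<in> W" and fy: "f y \<in> W" using x y Suc.prems(5) by auto
    have fxy: "f x \<noteq> f y" using inj x y pair(3) by (auto simp: inj_on_def)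
    have dom: "fst ` set st' = fst ` set st - {x, y}" unfolding st'_def by force
    let ?W = "W - {f x} - {f y}"
    have "\<exists>l. Q l \<and> set l \<subseteq> fst ` set st' \<and> red ?W (?W - f ` (fst ` set st' - set l))"
    proof (rule Suc.IH)
      show "elim n A Q st'" using pair(5) unfolding st'_def .
      show "distinct (map fst st')" using Suc.prems(3) unfolding st'_def
        by (auto simp: distinct_map comp_def case_prod_beta inj_on_def)
      show "inj_on f (fst ` set st')" using inj unfolding dom by (rule inj_on_subset) auto
      show "f ` fst ` set st' \<subseteq> ?W" using Suc.prems(5) inj x y unfolding dom
        by (auto simp: inj_on_def)
      show "d = odd_deg ?W (f z)" if "(z, d) \<in> set st'" for z d
      proof -
        from that obtain c where c: "(z, c) \<in> set st" "z \<noteq> x" "z \<noteq> y" "d = (c \<noteq> (A x z \<noteq> A y z))"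
          unfolding st'_def by auto
        have z: "z \<in> fst ` set st" using c(1) by force
        have "odd_deg ?W (f z) = ((odd_deg W (f z) \<noteq> ({f x, f z} \<in> E)) \<noteq> ({f y, f z} \<in> E))"
          using odd_deg_remove[OF Suc.prems(2) fx, of "f z"]
            odd_deg_remove[of "W - {f x}" "f y" "f z"] Suc.prems(2) fy fxy by simp
        then show ?thesis
          using par[OF c(1)] adj[OF x z] adj[OF y z] c by auto
      qed
    qed (use Suc.prems(2) adj dom in auto)
    then obtain l where l: "Q l" "set l \<subseteq> fst ` set st'"
      "red ?W (?W - f ` (fst ` set st' - set l))" by blast
    have r1: "red W ?W"
      using par[OF pair(1)] par[OF pair(2)] adj[OF x y] pair(3,4)
      by (intro red_odd_pair Suc.prems(2) fx fy fxy) simp_all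
    have eq: "?W - f ` (fst ` set st' - set l) = W - f ` (fst ` set st - set l)"
    proof -
      have "fst ` set st - set l = insert x (insert y (fst ` set st' - set l))"
        using l(2) x y unfolding dom by blast
      then show ?thesis by (simp only: image_insert) blast
    qed
    have "red W (W - f ` (fst ` set st - set l))" using red_trans[OF r1 l(3)] unfolding eq .
    moreover have "set l \<subseteq> fst ` set st" using l(2) unfolding dom by blast
    ultimately show ?thesis using l(1) by (intro exI[of _ l] conjI)
  qed
qed

text \<open>Which gadget vertices are lost is immaterial: the survivors still induce part of a
  matching, and this is all that is used of them.\<close>

lemma matching_absorbs:
  assumes "finite W" "{k, a, b, c, d} \<subseteq> W" "distinct [k, a, b, c, d]"
    "{a, b} \<in> E" "{c, d} \<in> E" "{a, c} \<notin> E" "{a, d} \<notin> E" "{b, c} \<notin> E" "{b, d} \<notin> E"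
  shows "\<exists>S\<subseteq>{a, b, c, d}. red W (W - {k} - S)"
proof (cases "odd_deg W k")
  case False
  then show ?thesis using assms red_even[of W k] by (intro exI[of _ "{}"]) auto
next
  case True
  define f where "f = (\<lambda>x. case x of Ka \<Rightarrow> k | A0 \<Rightarrow> a | B0 \<Rightarrow> b | A1 \<Rightarrow> c | B1 \<Rightarrow> d | _ \<Rightarrow> k)"
  define st where "st = [(Ka, True), (A0, odd_deg W a), (B0, odd_deg W b),
    (A1, odd_deg W c), (B1, odd_deg W d)]"
  have "elim 5 (matching_adj ({k, a} \<in> E) ({k, b} \<in> E) ({k, c} \<in> E) ({k, d} \<in> E))
     (\<lambda>l. \<not> List.member l Ka) st"
    unfolding st_def by (rule elim_matching[unfolded all_bool_iff, rule_format])
  then have "\<exists>l. \<not> List.member l Ka \<and> set l \<subseteq> fst ` set st \<and> red W (W - f ` (fst ` set st - set l))"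
  proof (rule elim_sound)
    show "matching_adj ({k, a} \<in> E) ({k, b} \<in> E) ({k, c} \<in> E) ({k, d} \<in> E) x y = ({f x, f y} \<in> E)"
      if "x \<in> fst ` set st" "y \<in> fst ` set st" "x \<noteq> y" for x y
      using that assms(4-) unfolding st_def matching_adj_def f_def
      by (auto simp: insert_commute)
  qed (use assms True in \<open>auto simp: st_def f_def inj_on_def\<close>)
  then obtain l where l: "Ka \<notin> set l" "red W (W - f ` (fst ` set st - set l))"
    by auto
  have "f ` (fst ` set st - set l) = {k} \<union> f ` ({A0, B0, A1, B1} - set l)"
  proof -
    have "fst ` set st - set l = insert Ka ({A0, B0, A1, B1} - set l)"
      using l(1) unfolding st_def by auto
    moreover have "f Ka = k" by (simp add: f_def)
    ultimately show ?thesis by (simp only: image_insert) blast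
  qed
  then have "W - f ` (fst ` set st - set l) = W - {k} - f ` ({A0, B0, A1, B1} - set l)" by auto
  with l(2) show ?thesis by (intro exI[of _ "f ` ({A0, B0, A1, B1} - set l)"]) (auto simp: f_def)
qed

section \<open>Absorbing a vertex by cherries\<close>

fun cherry :: "'a \<times> 'a \<times> 'a \<Rightarrow> bool" where
  "cherry (a, b, c) \<longleftrightarrow> distinct [a, b, c] \<and> {a, c} \<in> E \<and> {a, b} \<notin> E \<and> {b, c} \<notin> E"

fun tset :: "'a \<times> 'a \<times> 'a \<Rightarrow> 'a set" where
  "tset (a, b, c) = {a, b, c}"

definition joined :: "'a \<times> 'a \<times> 'a \<Rightarrow> 'a \<times> 'a \<times> 'a \<Rightarrow> bool" where
  "joined g h \<longleftrightarrow> (\<forall>x\<in>tset g. \<forall>y\<in>tset h. {x, y} \<in> E)"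

text \<open>
  The only configuration with an even parity sum in which an odd vertex \<open>k\<close> and a single cherry do
  not annihilate each other; among three cherries two agree in being special or not.
\<close>
fun special :: "'a set \<Rightarrow> 'a \<Rightarrow> 'a \<times> 'a \<times> 'a \<Rightarrow> bool" where
  "special W k (a, b, c) \<longleftrightarrow> {k, a} \<in> E \<and> {k, b} \<notin> E \<and> {k, c} \<in> E \<and>
     odd_deg W a \<and> \<not> odd_deg W b \<and> odd_deg W c"

text \<open>For odd \<open>k\<close> and a cherry, this is the parity of the number of edges lost
  when \<open>k\<close> and the whole cherry are deleted from \<open>W\<close>; if it holds, they
  cannot all disappear together.\<close>

fun parity_sum :: "'a set \<Rightarrow> 'a \<Rightarrow> 'a \<times> 'a \<times> 'a \<Rightarrow> bool" where
  "parity_sum W k (a, b, c) \<longleftrightarrow> (({k, a} \<in> E) \<noteq> (({k, b} \<in> E) \<noteq> (({k, c} \<in> E) \<noteq>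
     (odd_deg W a \<noteq> (odd_deg W b \<noteq> odd_deg W c)))))"

lemma cherry_local:
  assumes "finite W" "{k, a, b, c} \<subseteq> W" "k \<notin> {a, b, c}" "cherry (a, b, c)" "odd_deg W k"
    and "elim 4 (cherries_adj ({k, a} \<in> E) ({k, b} \<in> E) ({k, c} \<in> E) False False False) Q
      [(Ka, True), (A0, odd_deg W a), (B0, odd_deg W b), (C0, odd_deg W c)]"
  defines "f \<equiv> \<lambda>x. case x of Ka \<Rightarrow> k | A0 \<Rightarrow> a | B0 \<Rightarrow> b | C0 \<Rightarrow> c | _ \<Rightarrow> k"
  shows "\<exists>l. Q l \<and> red W (W - f ` ({Ka, A0, B0, C0} - set l))"
proof -
  define st where "st = [(Ka, True), (A0, odd_deg W a), (B0, odd_deg W b), (C0, odd_deg W c)]"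
  have "\<exists>l. Q l \<and> set l \<subseteq> fst ` set st \<and> red W (W - f ` (fst ` set st - set l))"
  proof (rule elim_sound[OF assms(6)[folded st_def]])
    show "cherries_adj ({k, a} \<in> E) ({k, b} \<in> E) ({k, c} \<in> E) False False False x y = ({f x, f y} \<in> E)"
      if "x \<in> fst ` set st" "y \<in> fst ` set st" "x \<noteq> y" for x y
      using that assms(4) unfolding st_def cherries_adj_def f_def
      by (auto simp: insert_commute)
  qed (use assms in \<open>auto simp: st_def inj_on_def\<close>)
  moreover have "fst ` set st = {Ka, A0, B0, C0}" unfolding st_def by auto
  ultimately show ?thesis by auto
qed

text \<open>It does not matter which cherry vertex is left over, so the three possible outcomes of
  the game are merged into one by renaming the vertices.\<close>

lemma cherry_eats:
  assumes "finite W" "tset g \<subseteq> W" "k \<in> W" "k \<notin> tset g" "cherry g" "odd_deg W k" "\<not> special W k g"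
  shows "red W (W - {k} - tset g) \<or>
    parity_sum W k g \<and> (\<exists>x y z. tset g = {x, y, z} \<and> distinct [x, y, z] \<and> red W (W - {k} - {x} - {y}))"
proof -
  obtain a b c where g: "g = (a, b, c)" by (cases g)
  let ?p = "parity_sum W k g"
  have "elim 4 (cherries_adj ({k, a} \<in> E) ({k, b} \<in> E) ({k, c} \<in> E) False False False)
      (\<lambda>l. l = [] \<or> ?p \<and> (l = [A0] \<or> l = [B0] \<or> l = [C0]))
      [(Ka, True), (A0, odd_deg W a), (B0, odd_deg W b), (C0, odd_deg W c)]"
    using elim_cherry[unfolded all_bool_iff, rule_format, of "{k, a} \<in> E" "{k, b} \<in> E" "{k, c} \<in> E"
        "odd_deg W a" "odd_deg W b" "odd_deg W c"] assms(7)
    unfolding g special.simps parity_sum.simps by (elim disjE) (simp only: simp_thms)+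
  from cherry_local[OF _ _ _ _ _ this] assms obtain l where l:
    "l = [] \<or> ?p \<and> (l = [A0] \<or> l = [B0] \<or> l = [C0])"
    "red W (W - (\<lambda>x. case x of Ka \<Rightarrow> k | A0 \<Rightarrow> a | B0 \<Rightarrow> b | C0 \<Rightarrow> c | _ \<Rightarrow> k) ` ({Ka, A0, B0, C0} - set l))"
    unfolding g by auto
  have d: "distinct [a, b, c]" using assms(5) g by simp
  from l(1) consider "l = []" | "?p" "l = [A0]" | "?p" "l = [B0]" | "?p" "l = [C0]" by blast
  then show ?thesis
  proof cases
    case 1
    have "W - {k, a, b, c} = W - {k} - {a, b, c}" by auto
    then show ?thesis using l(2) 1 g by simp
  next
    case 2
    have "W - {k, b, c} = W - {k} - {b} - {c}" by auto
    then have "red W (W - {k} - {b} - {c})" using l(2) 2 by (simp add: insert_Diff_if)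
    moreover have "tset g = {b, c, a}" using g by auto
    ultimately show ?thesis using 2 d by (intro disjI2 conjI exI) auto
  next
    case 3
    have "W - {k, a, c} = W - {k} - {a} - {c}" by auto
    then have "red W (W - {k} - {a} - {c})" using l(2) 3 by (simp add: insert_Diff_if)
    moreover have "tset g = {a, c, b}" using g by auto
    ultimately show ?thesis using 3 d by (intro disjI2 conjI exI) auto
  next
    case 4
    have "W - {k, a, b} = W - {k} - {a} - {b}" by auto
    then have "red W (W - {k} - {a} - {b})" using l(2) 4 by (simp add: insert_Diff_if)
    moreover have "tset g = {a, b, c}" using g by auto
    ultimately show ?thesis using 4 d by (intro disjI2 conjI exI) auto
  qed
qed

lemma joined_cherry_eats:
  assumes "finite W" "{a, b, c} \<subseteq> W" "k \<in> W" "k \<notin> {a, b, c}" "cherry (a, b, c)" "odd_deg W k"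
    "{k, a} \<in> E" "{k, b} \<in> E" "{k, c} \<in> E" "odd_deg W a \<noteq> (odd_deg W b \<noteq> odd_deg W c)"
  shows "red W (W - {k} - {a, b, c})"
proof -
  have "elim 4 (cherries_adj ({k, a} \<in> E) ({k, b} \<in> E) ({k, c} \<in> E) False False False)
      (\<lambda>l. l = []) [(Ka, True), (A0, odd_deg W a), (B0, odd_deg W b), (C0, odd_deg W c)]"
    using elim_joined_cherry assms(7-) unfolding all_bool_iff by simp
  from cherry_local[OF _ _ _ _ _ this] assms
  have "red W (W - {k, a, b, c})" by auto
  moreover have "W - {k, a, b, c} = W - {k} - {a, b, c}" by auto
  ultimately show ?thesis by simp
qed

lemma special_cherries_eat:
  assumes "finite W" "{k, a, b, c, a', b', c'} \<subseteq> W" "distinct [k, a, b, c, a', b', c']"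
    "cherry (a, b, c)" "cherry (a', b', c')" "joined (a, b, c) (a', b', c')" "odd_deg W k"
    "special W k (a, b, c)" "special W k (a', b', c')"
  shows "red W (W - {k} - {a, b, c} - {a', b', c'})"
proof -
  define f where "f = (\<lambda>x. case x of Ka \<Rightarrow> k | A0 \<Rightarrow> a | B0 \<Rightarrow> b | C0 \<Rightarrow> c | A1 \<Rightarrow> a' | B1 \<Rightarrow> b' | C1 \<Rightarrow> c')"
  define st where "st = [(Ka, True), (A0, True), (B0, False), (C0, True), (A1, True), (B1, False), (C1, True)]"
  have "\<exists>l. l = [] \<and> set l \<subseteq> fst ` set st \<and> red W (W - f ` (fst ` set st - set l))"
  proof (rule elim_sound[OF elim_special_cherries[folded st_def]])
    show "cherries_adj True False True True False True x y = ({f x, f y} \<in> E)"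
      if "x \<in> fst ` set st" "y \<in> fst ` set st" "x \<noteq> y" for x y
    proof -
      have "\<forall>x\<in>{a, b, c}. \<forall>y\<in>{a', b', c'}. {x, y} \<in> E \<and> {y, x} \<in> E"
        using assms(6) unfolding joined_def by (auto simp: insert_commute)
      moreover have "x \<noteq> y" by fact
      ultimately show ?thesis
        using assms(4,5,8,9) unfolding cherries_adj_def f_def
        by (cases x; cases y) (simp_all add: insert_commute)
    qed
    show "inj_on f (fst ` set st)"
      using assms(3) unfolding st_def f_def inj_on_def by auto
  qed (use assms in \<open>auto simp: st_def f_def\<close>)
  then have "red W (W - f ` {Ka, A0, B0, C0, A1, B1, C1})" by (simp add: st_def)
  moreover have "W - f ` {Ka, A0, B0, C0, A1, B1, C1} = W - {k} - {a, b, c} - {a', b', c'}"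
    by (auto simp: f_def)
  ultimately show ?thesis by simp
qed

lemma odd_deg_remove3:
  assumes "finite W" "{x, y, z} \<subseteq> W" "distinct [x, y, z]"
  shows "odd_deg (W - {x} - {y} - {z}) v \<longleftrightarrow>
    (((odd_deg W v \<noteq> ({x, v} \<in> E)) \<noteq> ({y, v} \<in> E)) \<noteq> ({z, v} \<in> E))"
proof -
  have "y \<in> W - {x}" "z \<in> W - {x} - {y}" "x \<in> W" using assms by auto
  then show ?thesis using assms(1) by (simp add: odd_deg_remove)
qed

text \<open>If neither cherry is special and neither vanishes together with an odd \<open>k\<close>,
  both parity sums are odd. Then \<open>g\<close> trades \<open>k\<close> for one of its own
  vertices \<open>z\<close>, which is joined to all of \<open>h\<close>, and the odd parity sum of
  \<open>h\<close> is precisely what \<open>h\<close> needs to absorb an odd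
  \<open>z\<close>.\<close>

lemma two_cherries_eat:
  assumes fin: "finite W" and sub: "tset g \<subseteq> W" "tset h \<subseteq> W" "k \<in> W"
    and k: "k \<notin> tset g" "k \<notin> tset h" and disj: "tset g \<inter> tset h = {}"
    and ch: "cherry g" "cherry h" "joined g h" and sp: "special W k g \<longleftrightarrow> special W k h"
  shows "\<exists>D\<subseteq>{g, h}. red W (W - {k} - \<Union> (tset ` D))"
proof -
  consider (even) "\<not> odd_deg W k" | (special) "odd_deg W k" "special W k g"
    | (normal) "odd_deg W k" "\<not> special W k g" "\<not> special W k h" using sp by blast
  then show ?thesis
  proof cases
    case even
    then show ?thesis using fin sub red_even[of W k] by (intro exI[of _ "{}"]) auto
  next
    case special
    obtain a b c where g: "g = (a, b, c)" by (cases g)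
    obtain a' b' c' where h: "h = (a', b', c')" by (cases h)
    have "red W (W - {k} - {a, b, c} - {a', b', c'})"
      using special sp assms unfolding g h by (intro special_cherries_eat) auto
    moreover have "W - {k} - {a, b, c} - {a', b', c'} = W - {k} - \<Union> (tset ` {g, h})"
      unfolding g h by auto
    ultimately show ?thesis by (intro exI[of _ "{g, h}"]) simp
  next
    case normal
    show ?thesis
    proof (cases "red W (W - {k} - tset g) \<or> red W (W - {k} - tset h)")
      case True
      then show ?thesis
      proof
        assume "red W (W - {k} - tset g)"
        then show ?thesis by (intro exI[of _ "{g}"]) simp
      next
        assume "red W (W - {k} - tset h)"
        then show ?thesis by (intro exI[of _ "{h}"]) simp
      qed
    next
      case False
      have ps: "parity_sum W k h"
        using cherry_eats[of W h k] assms normal False by blast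
      obtain x y z where xyz: "tset g = {x, y, z}" "distinct [x, y, z]" "red W (W - {k} - {x} - {y})"
        using cherry_eats[of W g k] assms normal False by blast
      let ?W = "W - {k} - {x} - {y}"
      obtain a b c where h: "h = (a, b, c)" by (cases h)
      have z: "z \<in> ?W" using xyz sub k by auto
      have D: "?W - {z} - {a, b, c} = W - {k} - \<Union> (tset ` {g, h})" using xyz h by auto
      have D': "?W - {z} = W - {k} - \<Union> (tset ` {g})" using xyz by auto
      show ?thesis
      proof (cases "odd_deg ?W z")
        case False
        then have "red W (?W - {z})" using red_trans[OF xyz(3) red_even] fin z by blast
        then show ?thesis unfolding D' by (intro exI[of _ "{g}"]) simp
      next
        case True
        have adj: "{u, v} \<in> E" if "u \<in> {x, y, z}" "v \<in> {a, b, c}" for u v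
          using that ch(3) xyz(1) h unfolding joined_def by auto
        \<comment> \<open>\<open>x\<close> and \<open>y\<close> are both adjacent to every vertex of
          \<open>h\<close>, so their deletions cancel and only that of \<open>k\<close>
          counts.\<close>
        have od: "odd_deg ?W v \<longleftrightarrow> odd_deg W v \<noteq> ({k, v} \<in> E)" if "v \<in> {a, b, c}" for v
        proof -
          have "odd_deg ?W v \<longleftrightarrow> (((odd_deg W v \<noteq> ({k, v} \<in> E)) \<noteq> ({x, v} \<in> E)) \<noteq> ({y, v} \<in> E))"
            using fin sub xyz k by (intro odd_deg_remove3) auto
          then show ?thesis using adj[of x v] adj[of y v] that by simp
        qed
        have "red ?W (?W - {z} - {a, b, c})"
        proof (rule joined_cherry_eats)
          show "odd_deg ?W a \<noteq> (odd_deg ?W b \<noteq> odd_deg ?W c)"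
            using ps od[of a] od[of b] od[of c] unfolding h by simp argo
          show "{a, b, c} \<subseteq> ?W" using sub disj h xyz(1) k by auto
          show "z \<notin> {a, b, c}" using disj h xyz(1) by auto
        qed (use adj ch True z fin h in auto)
        then have "red W (W - {k} - \<Union> (tset ` {g, h}))"
          using red_trans[OF xyz(3)] unfolding D by blast
        then show ?thesis by (intro exI[of _ "{g, h}"]) simp
      qed
    qed
  qed
qed

end

section \<open>Absorbers\<close>

context simple_graph
begin

lemma odd_deg_Diff:
  assumes "finite W" "S \<subseteq> W"
  shows "odd_deg (W - S) v \<longleftrightarrow> odd_deg W v \<noteq> odd (card (nb S v))"
proof -
  have "nb W v = nb (W - S) v \<union> nb S v" "nb (W - S) v \<inter> nb S v = {}"
    using assms(2) by (auto simp: nb_def)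
  moreover have "finite (nb (W - S) v)" "finite (nb S v)"
    using assms by (auto simp: nb_def intro: finite_subset)
  ultimately have "card (nb W v) = card (nb (W - S) v) + card (nb S v)"
    by (simp add: card_Un_disjoint)
  then show ?thesis unfolding odd_deg_def by (simp only: even_add) blast
qed

lemma nb_eq_self: "(\<And>u. u \<in> S \<Longrightarrow> {u, v} \<in> E) \<Longrightarrow> nb S v = S"
  unfolding nb_def by auto

text \<open>The first clause is for all absorbers but the last: \<open>T\<close> is used up, and
  \<open>R\<close> contains the ones still waiting. The second is for the last one, when nothing but
  \<open>K \<union> T\<close> is left.\<close>

definition absorber :: "nat \<Rightarrow> 'a set \<Rightarrow> bool" where
  "absorber b T \<longleftrightarrow> finite T \<and> T \<noteq> {} \<and>
     (\<forall>K R. finite K \<longrightarrow> finite R \<longrightarrow> K \<inter> T = {} \<longrightarrow> K \<inter> R = {} \<longrightarrow> T \<inter> R = {} \<longrightarrow>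
        (\<exists>K'\<subseteq>K \<union> T. card K' \<le> max (card K - 1) b \<and> red (K \<union> T \<union> R) (K' \<union> R))) \<and>
     (\<forall>K. finite K \<longrightarrow> K \<inter> T = {} \<longrightarrow> card K \<le> b \<longrightarrow> even_edges (K \<union> T) \<longrightarrow> even_dec E (K \<union> T))"

text \<open>After one round \<open>K'\<close> may contain vertices of the spent absorber and need
  not be a clique. This is why absorbers are required to work against arbitrary sets.\<close>

lemma absorb_all:
  assumes "finite \<F>" "\<And>T. T \<in> \<F> \<Longrightarrow> absorber b T" "pairwise disjnt \<F>"
    "finite K" "finite R" "K \<inter> \<Union>\<F> = {}" "K \<inter> R = {}" "\<Union>\<F> \<inter> R = {}" "card K \<le> card \<F> + b"
  shows "\<exists>K'\<subseteq>K \<union> \<Union>\<F>. card K' \<le> b \<and> red (K \<union> \<Union>\<F> \<union> R) (K' \<union> R)"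
  using assms
proof (induction \<F> arbitrary: K rule: finite_induct)
  case empty
  then show ?case by (intro exI[of _ K]) (auto intro: red_refl)
next
  case (insert T \<F>)
  have fin: "finite (\<Union>\<F> \<union> R)" using insert by (auto simp: absorber_def)
  have T: "T \<inter> \<Union>\<F> = {}"
    using insert.prems(2) insert.hyps(2) by (auto simp: pairwise_def disjnt_def)
  have absT: "absorber b T" using insert.prems(1) by simp
  have "\<exists>K'\<subseteq>K \<union> T. card K' \<le> max (card K - 1) b \<and>
      red (K \<union> T \<union> (\<Union>\<F> \<union> R)) (K' \<union> (\<Union>\<F> \<union> R))"
  proof -
    have "K \<inter> T = {}" "K \<inter> (\<Union>\<F> \<union> R) = {}" "T \<inter> (\<Union>\<F> \<union> R) = {}"
      using insert.prems(5-7) T by auto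
    then show ?thesis using absT insert.prems(3) fin unfolding absorber_def by simp
  qed
  then obtain K' where K': "K' \<subseteq> K \<union> T" "card K' \<le> max (card K - 1) b"
    "red (K \<union> T \<union> (\<Union>\<F> \<union> R)) (K' \<union> (\<Union>\<F> \<union> R))" by blast
  have finT: "finite T" using \<open>absorber b T\<close> by (simp add: absorber_def)
  have "\<exists>K''\<subseteq>K' \<union> \<Union>\<F>. card K'' \<le> b \<and> red (K' \<union> \<Union>\<F> \<union> R) (K'' \<union> R)"
  proof (rule insert.IH)
    show "pairwise disjnt \<F>" using insert.prems(2) by (simp add: pairwise_insert)
    show "finite K'" using K'(1) finT insert.prems(3) finite_subset by blast
    show "card K' \<le> card \<F> + b" using K'(2) insert.prems(8) insert.hyps by simp
    show "K' \<inter> \<Union>\<F> = {}" "K' \<inter> R = {}" "\<Union>\<F> \<inter> R = {}"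
      using insert.prems(5-7) K'(1) T unfolding Union_insert by blast+
  qed (use insert.prems(1,4) in auto)
  then obtain K'' where K'': "K'' \<subseteq> K' \<union> \<Union>\<F>" "card K'' \<le> b" "red (K' \<union> \<Union>\<F> \<union> R) (K'' \<union> R)" by blast
  have "red (K \<union> \<Union>(insert T \<F>) \<union> R) (K'' \<union> R)"
    using red_trans[OF K'(3)] K''(3) by (simp add: Un_assoc)
  then show ?case using K'' K'(1) by (intro exI[of _ K'']) auto
qed

text \<open>One absorber is withheld to clear the last \<open>b\<close> vertices, so only
  \<open>card \<F> - 1\<close> of them are available for shrinking the clique; this explains the
  strict inequality.\<close>

theorem even_dec_of_absorbers:
  assumes "finite V" "even_edges V" "finite \<F>" "\<F> \<noteq> {}" "\<And>T. T \<in> \<F> \<Longrightarrow> absorber b T \<and> T \<subseteq> V"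
    "pairwise disjnt \<F>" "\<And>K. K \<subseteq> V \<Longrightarrow> clique K \<Longrightarrow> card K < card \<F> + b"
  shows "even_dec E V"
proof -
  obtain T where T: "T \<in> \<F>" using assms(4) by blast
  let ?G = "\<F> - {T}"
  have disj: "T \<inter> \<Union>?G = {}" using assms(6) T by (fastforce simp: pairwise_def disjnt_def)
  have V: "\<Union>\<F> = \<Union>?G \<union> T" using T by auto
  have sub: "\<Union>\<F> \<subseteq> V" using assms(5) by auto
  have finF: "finite (\<Union>\<F>)" using sub assms(1) finite_subset by blast
  obtain K where K: "K \<subseteq> V - \<Union>\<F>" "clique K" "red ((V - \<Union>\<F>) \<union> \<Union>\<F>) (K \<union> \<Union>\<F>)"
    using reduce_to_clique[of "V - \<Union>\<F>" "\<Union>\<F>"] assms(1) finF by auto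
  have finK: "finite K" using K(1) assms(1) finite_subset by blast
  have "card K < card \<F> + b" using K assms(7) by blast
  then have c: "card K \<le> card ?G + b" using T assms(3) by simp
  have "\<exists>K'\<subseteq>K \<union> \<Union>?G. card K' \<le> b \<and> red (K \<union> \<Union>?G \<union> T) (K' \<union> T)"
  proof (rule absorb_all)
    show "pairwise disjnt ?G" using assms(6) by (auto simp: pairwise_def)
    show "finite T" using assms(5) T by (auto simp: absorber_def)
    show "card K \<le> card ?G + b" by (rule c)
  qed (use assms finK K(1) disj T in \<open>auto\<close>)
  then obtain K' where K': "K' \<subseteq> K \<union> \<Union>?G" "card K' \<le> b" "red (K \<union> \<Union>?G \<union> T) (K' \<union> T)" by blast
  have "red V (K' \<union> T)"
    using red_trans[OF K(3), of "K' \<union> T"] K'(3) sub V by (simp add: Un_assoc Un_absorb2)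
  moreover have "K' \<inter> T = {}" using K'(1) K(1) disj T by blast
  moreover have "finite K'" using K'(1) finK finF V by (auto intro: finite_subset)
  ultimately show ?thesis using assms(2,5) T K'(2) unfolding red_def absorber_def by blast
qed

section \<open>Induced copies of patterns, and matchings as absorbers\<close>

definition copy :: "(nat \<Rightarrow> nat \<Rightarrow> bool) \<Rightarrow> nat \<Rightarrow> (nat \<Rightarrow> 'a) \<Rightarrow> bool" where
  "copy A m f \<longleftrightarrow> inj_on f {..<m} \<and> (\<forall>i<m. \<forall>j<m. i \<noteq> j \<longrightarrow> {f i, f j} \<in> E \<longleftrightarrow> A i j)"

definition matching_pattern :: "nat \<Rightarrow> nat \<Rightarrow> bool" where
  "matching_pattern i j \<longleftrightarrow> i div 2 = j div 2"

text \<open>Indices \<open>3 * q\<close>, \<open>3 * q + 1\<close>, \<open>3 * q + 2\<close> form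
  one cherry with middle \<open>3 * q + 1\<close>; the complement is a disjoint union of paths on
  three vertices.\<close>

definition cherry_pattern :: "nat \<Rightarrow> nat \<Rightarrow> bool" where
  "cherry_pattern i j \<longleftrightarrow> \<not> (i div 3 = j div 3 \<and> (i mod 3 = 1 \<or> j mod 3 = 1))"

lemma copy_mono: "copy A m f \<Longrightarrow> l \<le> m \<Longrightarrow> copy A l f"
  unfolding copy_def by (auto intro: inj_on_subset)

text \<open>One block of four vertices, that is two matching edges, pays for one vertex of
  \<open>K\<close>. The truncated difference \<open>card K - m\<close> covers the case that
  \<open>K\<close> is exhausted early.\<close>

lemma matching_copy_absorbs:
  assumes "copy matching_pattern (4 * m) f" "finite K" "finite R" "K \<inter> f ` {..<4 * m} = {}"
    "K \<inter> R = {}" "f ` {..<4 * m} \<inter> R = {}"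
  shows "\<exists>K'\<subseteq>K. \<exists>T'\<subseteq>f ` {..<4 * m}. card K' \<le> card K - m \<and>
           red (K \<union> f ` {..<4 * m} \<union> R) (K' \<union> T' \<union> R)"
  using assms
proof (induction m arbitrary: K R)
  case 0
  then show ?case by (intro exI[of _ K] conjI exI[of _ "{}"]) (auto intro: red_refl)
next
  case (Suc m)
  let ?T = "f ` {..<4 * m}"
  let ?B = "{f (4 * m), f (4 * m + 1), f (4 * m + 2), f (4 * m + 3)}"
  have idx: "{..<4 * Suc m} = {..<4 * m} \<union> {4 * m, 4 * m + 1, 4 * m + 2, 4 * m + 3}" by auto
  have T: "f ` {..<4 * Suc m} = ?T \<union> ?B" unfolding idx by auto
  have inj: "inj_on f {..<4 * Suc m}" using Suc.prems(1) by (simp add: copy_def)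
  have adj: "{f i, f j} \<in> E \<longleftrightarrow> i div 2 = j div 2" if "i < 4 * Suc m" "j < 4 * Suc m" "i \<noteq> j" for i j
    using Suc.prems(1) that unfolding copy_def matching_pattern_def by blast
  have TB: "?T \<inter> ?B = {}"
    using inj unfolding inj_on_def by (force simp: image_iff)
  show ?case
  proof (cases "K = {}")
    case True
    then show ?thesis
      by (intro exI[of _ K] conjI exI[of _ "f ` {..<4 * Suc m}"]) (auto intro: red_refl)
  next
    case False
    then obtain k where k: "k \<in> K" by blast
    let ?W = "K \<union> f ` {..<4 * Suc m} \<union> R"
    have "\<exists>S\<subseteq>?B. red ?W (?W - {k} - S)"
    proof (rule matching_absorbs)
      show "finite ?W" using Suc.prems by simp
      show "distinct [k, f (4 * m), f (4 * m + 1), f (4 * m + 2), f (4 * m + 3)]"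
        using k Suc.prems(4) inj unfolding T by (auto simp: inj_on_eq_iff)
      show "{k, f (4 * m), f (4 * m + 1), f (4 * m + 2), f (4 * m + 3)} \<subseteq> ?W"
        using k unfolding T by auto
    qed (auto simp: adj)
    then obtain S where S: "S \<subseteq> ?B" "red ?W (?W - {k} - S)" by blast
    \<comment> \<open>The survivors of the spent block are parked in the untouched part, so that the
      induction cannot delete them; they return as part of the final \<open>T'\<close>.\<close>
    let ?R = "R \<union> (?B - S)"
    have "\<exists>K'\<subseteq>K - {k}. \<exists>T'\<subseteq>?T. card K' \<le> card (K - {k}) - m \<and>
        red ((K - {k}) \<union> ?T \<union> ?R) (K' \<union> T' \<union> ?R)"
    proof (rule Suc.IH)
      show "copy matching_pattern (4 * m) f" using Suc.prems(1) by (rule copy_mono) simp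
      show "(K - {k}) \<inter> ?R = {}" using Suc.prems unfolding T by blast
      show "?T \<inter> ?R = {}" using Suc.prems(6) TB unfolding T by blast
      show "(K - {k}) \<inter> ?T = {}" using Suc.prems(4) unfolding T by blast
    qed (use Suc.prems in auto)
    then obtain K' T' where K': "K' \<subseteq> K - {k}" "T' \<subseteq> ?T" "card K' \<le> card (K - {k}) - m"
      "red ((K - {k}) \<union> ?T \<union> ?R) (K' \<union> T' \<union> ?R)" by blast
    have "?W - {k} - S = (K - {k}) \<union> ?T \<union> ?R"
      using S(1) k Suc.prems(4,5,6) TB unfolding T by blast
    then have "red ?W (K' \<union> T' \<union> ?R)" using red_trans[OF S(2)] K'(4) by simp
    moreover have "K' \<union> T' \<union> ?R = K' \<union> (T' \<union> (?B - S)) \<union> R" by blast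
    moreover have "T' \<union> (?B - S) \<subseteq> f ` {..<4 * Suc m}" using K'(2) unfolding T by blast
    moreover have "card K' \<le> card K - Suc m" using K'(3) k Suc.prems(2) by simp
    moreover have "K' \<subseteq> K" using K'(1) by blast
    ultimately show ?thesis by (intro exI[of _ K'] conjI exI[of _ "T' \<union> (?B - S)"]) simp_all
  qed
qed

lemma matching_clique:
  assumes "copy matching_pattern m f" "K \<subseteq> f ` {..<m}" "clique K"
  shows "card K \<le> 2"
proof -
  have fin: "finite K" using assms(2) finite_subset by blast
  have "x = y \<or> x = z \<or> y = z" if xyz: "x \<in> K" "y \<in> K" "z \<in> K" for x y z
  proof (rule ccontr)
    assume neq: "\<not> ?thesis"
    from xyz assms(2) obtain i j l where ijl: "x = f i" "y = f j" "z = f l" "i < m" "j < m" "l < m"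
      by blast
    have "i div 2 = j div 2" "i div 2 = l div 2"
      using assms(1,3) xyz neq ijl unfolding copy_def clique_def matching_pattern_def by blast+
    moreover have "i \<noteq> j" "i \<noteq> l" "j \<noteq> l" using neq ijl by auto
    moreover have "i mod 2 = j mod 2 \<or> i mod 2 = l mod 2 \<or> j mod 2 = l mod 2"
      using mod_less_divisor[of 2 i] mod_less_divisor[of 2 j] mod_less_divisor[of 2 l] by linarith
    ultimately show False by (metis div_mult_mod_eq)
  qed
  note three = this
  show ?thesis
  proof (rule ccontr)
    assume "\<not> card K \<le> 2"
    then have "3 \<le> card K" by simp
    then obtain S where "S \<subseteq> K" "card S = 3" using obtain_subset_with_card_n by metis
    then obtain x y z where "S = {x, y, z}" "x \<noteq> y" "y \<noteq> z" "x \<noteq> z" by (auto simp: card_3_iff)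
    then show False using three[of x y z] \<open>S \<subseteq> K\<close> by blast
  qed
qed

text \<open>Three blocks remove three vertices of \<open>K\<close>, and what remains of the matching
  collapses to a clique with at most two vertices: a net loss of at least one, with residue 2. If
  \<open>K\<close> has at most two vertices it disappears entirely, and the remaining part of a
  matching has no clique large enough to be stuck.\<close>

theorem absorber_matching:
  assumes "copy matching_pattern 12 f"
  shows "absorber 2 (f ` {..<12})"
  unfolding absorber_def
proof (intro conjI allI impI)
  let ?T = "f ` {..<12}"
  fix K R assume fin: "finite K" "finite R" and disj: "K \<inter> ?T = {}" "K \<inter> R = {}" "?T \<inter> R = {}"
  obtain K1 T1 where K1: "K1 \<subseteq> K" "T1 \<subseteq> ?T" "card K1 \<le> card K - 3" "red (K \<union> ?T \<union> R) (K1 \<union> T1 \<union> R)"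
    using matching_copy_absorbs[of 3 f K R] assms fin disj by auto
  have "finite K1" "finite T1" using K1 fin finite_subset by blast+
  then obtain K2 where K2: "K2 \<subseteq> T1" "clique K2" "red (T1 \<union> (K1 \<union> R)) (K2 \<union> (K1 \<union> R))"
  proof -
    have "T1 \<inter> (K1 \<union> R) = {}" using K1(1,2) disj by blast
    with reduce_to_clique[of T1 "K1 \<union> R"] \<open>finite K1\<close> \<open>finite T1\<close> fin(2) that show thesis by auto
  qed
  have "card K2 \<le> 2" using matching_clique[OF assms _ K2(2)] K2(1) K1(2) by blast
  then have "card (K1 \<union> K2) \<le> card K - 3 + 2" using K1(3) card_Un_le[of K1 K2] by linarith
  then have "card (K1 \<union> K2) \<le> max (card K - 1) 2" by linarith
  moreover have "red (K \<union> ?T \<union> R) (K1 \<union> K2 \<union> R)"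
    using red_trans[OF K1(4), of "K1 \<union> K2 \<union> R"] K2(3) by (simp add: ac_simps)
  ultimately show "\<exists>K'\<subseteq>K \<union> ?T. card K' \<le> max (card K - 1) 2 \<and> red (K \<union> ?T \<union> R) (K' \<union> R)"
    using K1 K2 by (intro exI[of _ "K1 \<union> K2"]) auto
next
  let ?T = "f ` {..<12}"
  fix K assume fin: "finite K" and disj: "K \<inter> ?T = {}" and c: "card K \<le> 2" "even_edges (K \<union> ?T)"
  obtain K1 T1 where K1: "K1 \<subseteq> K" "T1 \<subseteq> ?T" "card K1 \<le> card K - 3" "red (K \<union> ?T) (K1 \<union> T1)"
    using matching_copy_absorbs[of 3 f K "{}"] assms fin disj by auto
  have "K1 = {}" using K1(1,3) c(1) fin finite_subset by fastforce
  moreover have "even_dec E T1" if "even_edges T1"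
  proof (rule even_dec_of_small_cliques[OF _ that])
    show "finite T1" using K1(2) finite_subset by blast
    show "card K \<le> 3" if "K \<subseteq> T1" "clique K" for K
      using matching_clique[OF assms _ that(2)] that(1) K1(2) by fastforce
  qed
  ultimately show "even_dec E (K \<union> ?T)" using K1(4) c(2) by (simp add: red_def)
qed (auto simp: lessThan_empty_iff)


section \<open>Joins of cherries as absorbers\<close>

definition cherry_join :: "('a \<times> 'a \<times> 'a) set \<Rightarrow> bool" where
  "cherry_join \<G> \<longleftrightarrow> finite \<G> \<and> (\<forall>g\<in>\<G>. cherry g) \<and>
     (\<forall>g\<in>\<G>. \<forall>h\<in>\<G>. g \<noteq> h \<longrightarrow> tset g \<inter> tset h = {} \<and> joined g h)"

definition verts :: "('a \<times> 'a \<times> 'a) set \<Rightarrow> 'a set" where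
  "verts \<G> = \<Union> (tset ` \<G>)"

lemma verts_empty [simp]: "verts {} = {}"
  by (simp add: verts_def)

lemma verts_insert [simp]: "verts (insert g \<G>) = tset g \<union> verts \<G>"
  by (simp add: verts_def)

lemma verts_mono: "\<H> \<subseteq> \<G> \<Longrightarrow> verts \<H> \<subseteq> verts \<G>"
  by (auto simp: verts_def)

lemma tset_subset_verts: "g \<in> \<G> \<Longrightarrow> tset g \<subseteq> verts \<G>"
  by (auto simp: verts_def)

lemma finite_tset [simp]: "finite (tset g)"
  by (cases g) simp

lemma card_tset: "cherry g \<Longrightarrow> card (tset g) = 3"
  by (cases g) auto

lemma cherry_join_subset: "cherry_join \<G> \<Longrightarrow> \<H> \<subseteq> \<G> \<Longrightarrow> cherry_join \<H>"
  unfolding cherry_join_def using finite_subset by blast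

lemma finite_verts: "cherry_join \<G> \<Longrightarrow> finite (verts \<G>)"
  unfolding cherry_join_def verts_def by auto

lemma verts_disjoint:
  assumes "cherry_join \<G>" "\<H> \<subseteq> \<G>" "\<H>' \<subseteq> \<G>" "\<H> \<inter> \<H>' = {}"
  shows "verts \<H> \<inter> verts \<H>' = {}"
proof -
  have "tset g \<inter> tset h = {}" if "g \<in> \<H>" "h \<in> \<H>'" for g h
  proof -
    have "g \<in> \<G>" "h \<in> \<G>" "g \<noteq> h" using that assms by auto
    then show ?thesis using assms(1) unfolding cherry_join_def by blast
  qed
  then show ?thesis by (simp add: Int_UN_distrib2 verts_def)
qed

lemma card_verts: "cherry_join \<G> \<Longrightarrow> card (verts \<G>) = 3 * card \<G>"
  unfolding cherry_join_def verts_def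
  by (subst card_UN_disjoint) (auto simp: card_tset)

lemma verts_Diff:
  assumes "cherry_join \<G>" "\<H> \<subseteq> \<G>"
  shows "verts \<G> - verts \<H> = verts (\<G> - \<H>)"
proof -
  have "verts \<G> = verts \<H> \<union> verts (\<G> - \<H>)" using assms(2) unfolding verts_def by blast
  moreover have "verts \<H> \<inter> verts (\<G> - \<H>) = {}" using assms by (intro verts_disjoint) auto
  ultimately show ?thesis by blast
qed

text \<open>Among three cherries two agree in being special or not, and these two suffice for one
  vertex. The last inequality records that at most two cherries are spent per absorbed vertex; the
  process halts early only when at most two cherries are left.\<close>

lemma cherries_eat:
  assumes "cherry_join \<G>" "finite K" "finite R" "K \<inter> verts \<G> = {}" "K \<inter> R = {}" "verts \<G> \<inter> R = {}"
  shows "\<exists>K'\<subseteq>K. \<exists>\<G>'\<subseteq>\<G>. red (K \<union> verts \<G> \<union> R) (K' \<union> verts \<G>' \<union> R) \<and>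
    (K' = {} \<or> card \<G>' \<le> 2) \<and> card \<G> + 2 * card K' \<le> card \<G>' + 2 * card K"
  using assms
proof (induction "card K" arbitrary: K \<G>)
  case 0
  then show ?case by (intro exI[of _ K] conjI exI[of _ \<G>]) (auto intro: red_refl)
next
  case (Suc n)
  have finG: "finite \<G>" using Suc.prems(1) by (simp add: cherry_join_def)
  show ?case
  proof (cases "card \<G> \<le> 2")
    case True
    then show ?thesis by (intro exI[of _ K] conjI exI[of _ \<G>]) (auto intro: red_refl)
  next
    case False
    obtain k where k: "k \<in> K" using Suc.hyps(2) by fastforce
    let ?W = "K \<union> verts \<G> \<union> R"
    obtain \<S> where "\<S> \<subseteq> \<G>" "card \<S> = 3" using False obtain_subset_with_card_n[of 3 \<G>] by auto
    then obtain g1 g2 g3 where g123: "g1 \<in> \<G>" "g2 \<in> \<G>" "g3 \<in> \<G>" "g1 \<noteq> g2" "g1 \<noteq> g3" "g2 \<noteq> g3"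
      by (auto simp: card_3_iff)
    obtain g h where gh: "g \<in> \<G>" "h \<in> \<G>" "g \<noteq> h" "special ?W k g \<longleftrightarrow> special ?W k h"
    proof (cases "special ?W k g1 \<longleftrightarrow> special ?W k g2")
      case True
      then show ?thesis using that g123 by blast
    next
      case ne: False
      show ?thesis
      proof (cases "special ?W k g1 \<longleftrightarrow> special ?W k g3")
        case True
        then show ?thesis using that g123 by blast
      next
        case False
        then show ?thesis using ne that[of g2 g3] g123 by blast
      qed
    qed
    have sub: "tset g \<subseteq> verts \<G>" "tset h \<subseteq> verts \<G>" using gh by (auto dest: tset_subset_verts)
    have "\<exists>D\<subseteq>{g, h}. red ?W (?W - {k} - \<Union> (tset ` D))"
    proof (rule two_cherries_eat)
      show "finite ?W" using Suc.prems finite_verts by simp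
      show "tset g \<inter> tset h = {}" "joined g h" "cherry g" "cherry h"
        using Suc.prems(1) gh unfolding cherry_join_def by blast+
      show "k \<notin> tset g" "k \<notin> tset h" using k sub Suc.prems(4) by blast+
      show "special ?W k g \<longleftrightarrow> special ?W k h" by (rule gh(4))
    qed (use sub k in auto)
    then obtain D where D: "D \<subseteq> {g, h}" "red ?W (?W - {k} - verts D)" unfolding verts_def by blast
    have DG: "D \<subseteq> \<G>" using D(1) gh by auto
    have cD: "card D \<le> 2" using card_mono[OF _ D(1)] gh(3) by simp
    have cK: "card (K - {k}) = n" using Suc.hyps(2) k Suc.prems(2) by simp
    have vsub: "verts (\<G> - D) \<subseteq> verts \<G>" "verts D \<subseteq> verts \<G>" using DG by (auto intro: verts_mono[THEN subsetD])
    have eq: "?W - {k} - verts D = (K - {k}) \<union> verts (\<G> - D) \<union> R"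
    proof -
      have "k \<notin> verts (\<G> - D)" "k \<notin> R" "(K - {k}) \<inter> verts D = {}" "R \<inter> verts D = {}"
        using k Suc.prems(4-6) vsub by blast+
      then show ?thesis using verts_Diff[OF Suc.prems(1) DG] by blast
    qed
    have "\<exists>K'\<subseteq>K - {k}. \<exists>\<G>'\<subseteq>\<G> - D. red ((K - {k}) \<union> verts (\<G> - D) \<union> R) (K' \<union> verts \<G>' \<union> R) \<and>
        (K' = {} \<or> card \<G>' \<le> 2) \<and> card (\<G> - D) + 2 * card K' \<le> card \<G>' + 2 * card (K - {k})"
    proof (rule Suc.hyps(1))
      show "cherry_join (\<G> - D)" using Suc.prems(1) by (rule cherry_join_subset) auto
      show "(K - {k}) \<inter> verts (\<G> - D) = {}" "(K - {k}) \<inter> R = {}" "verts (\<G> - D) \<inter> R = {}"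
        using Suc.prems(4-6) vsub by blast+
    qed (use cK Suc.prems(2,3) in auto)
    then obtain K' \<G>' where K': "K' \<subseteq> K - {k}" "\<G>' \<subseteq> \<G> - D"
      "red ((K - {k}) \<union> verts (\<G> - D) \<union> R) (K' \<union> verts \<G>' \<union> R)" "K' = {} \<or> card \<G>' \<le> 2"
      "card (\<G> - D) + 2 * card K' \<le> card \<G>' + 2 * card (K - {k})" by blast
    have "card \<G> \<le> card (\<G> - D) + 2"
      using cD finG DG card_Diff_subset[of D \<G>] finite_subset[OF DG finG] by simp
    then have "card \<G> + 2 * card K' \<le> card \<G>' + 2 * card K"
      using K'(5) cK Suc.hyps(2) by simp
    moreover have "red ?W (K' \<union> verts \<G>' \<union> R)" using red_trans[OF D(2)] K'(3) unfolding eq by simp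
    moreover have "K' \<subseteq> K" "\<G>' \<subseteq> \<G>" using K'(1,2) by blast+
    ultimately show ?thesis using K'(4) by (intro exI[of _ K'] conjI exI[of _ \<G>'])
  qed
qed

lemma cherries_dissolve:
  assumes "cherry_join \<G>" "finite R" "verts \<G> \<inter> R = {}"
  shows "\<exists>K'\<subseteq>verts \<G>. card K' \<le> 9 \<and> red (verts \<G> \<union> R) (K' \<union> R)"
  using assms
proof (induction "card \<G>" arbitrary: \<G> rule: less_induct)
  case less
  have finG: "finite \<G>" using less.prems(1) by (simp add: cherry_join_def)
  show ?case
  proof (cases "card \<G> \<le> 2")
    case True
    then show ?thesis using card_verts[OF less.prems(1)]
      by (intro exI[of _ "verts \<G>"]) (auto intro: red_refl)
  next
    case False
    then obtain g where g: "g \<in> \<G>" by (metis all_not_in_conv card.empty zero_le)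
    let ?H = "\<G> - {g}"
    have H: "cherry_join ?H" using less.prems(1) by (rule cherry_join_subset) auto
    have V: "verts \<G> = tset g \<union> verts ?H" using verts_insert[of g ?H] g by (simp add: insert_absorb)
    have d: "tset g \<inter> verts ?H = {}" using verts_disjoint[of \<G> "{g}" ?H] less.prems(1) g by auto
    have "\<exists>K'\<subseteq>tset g. \<exists>\<G>'\<subseteq>?H. red (tset g \<union> verts ?H \<union> R) (K' \<union> verts \<G>' \<union> R) \<and>
      (K' = {} \<or> card \<G>' \<le> 2) \<and> card ?H + 2 * card K' \<le> card \<G>' + 2 * card (tset g)"
      using less.prems(2,3) d unfolding V by (intro cherries_eat H) auto
    then obtain K' \<G>' where K': "K' \<subseteq> tset g" "\<G>' \<subseteq> ?H" "red (verts \<G> \<union> R) (K' \<union> verts \<G>' \<union> R)"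
      "K' = {} \<or> card \<G>' \<le> 2" unfolding V by blast
    have G': "cherry_join \<G>'" using K'(2) H by (rule cherry_join_subset[rotated])
    have sub: "verts \<G>' \<subseteq> verts \<G>" "tset g \<subseteq> verts \<G>"
      using K'(2) g by (auto intro!: verts_mono tset_subset_verts)
    show ?thesis
    proof (cases "card \<G>' \<le> 2")
      case True
      have "card (K' \<union> verts \<G>') \<le> card K' + card (verts \<G>')" by (rule card_Un_le)
      moreover have "card K' \<le> 3" using card_mono[OF _ K'(1)] card_tset[of g] less.prems(1) g
        by (simp add: cherry_join_def)
      ultimately have "card (K' \<union> verts \<G>') \<le> 9" using card_verts[OF G'] True by simp
      then show ?thesis using K'(1,3) sub by (intro exI[of _ "K' \<union> verts \<G>'"]) auto
    next
      case big: False
      then have "K' = {}" using K'(4) by simp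
      have "card \<G>' < card \<G>" using K'(2) g finG by (intro psubset_card_mono) auto
      moreover have "verts \<G>' \<inter> R = {}" using sub less.prems(3) by blast
      ultimately obtain K'' where "K'' \<subseteq> verts \<G>'" "card K'' \<le> 9" "red (verts \<G>' \<union> R) (K'' \<union> R)"
        using less.hyps[of \<G>'] G' less.prems(2) by blast
      then show ?thesis using red_trans[OF K'(3)] \<open>K' = {}\<close> sub
        by (intro exI[of _ K'']) auto
    qed
  qed
qed

text \<open>Every other cherry contributes three neighbours, so together they contribute the parity
  of \<open>card \<G> - 1\<close>; an end has one neighbour in its own cherry, the middle vertex
  none.\<close>

lemma odd_deg_cherry_join:
  assumes \<G>: "cherry_join \<G>" and g: "(a, b, c) \<in> \<G>"
  shows "odd_deg (verts \<G>) a \<longleftrightarrow> odd (card \<G>)" "odd_deg (verts \<G>) b \<longleftrightarrow> even (card \<G>)"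
    "odd_deg (verts \<G>) c \<longleftrightarrow> odd (card \<G>)"
proof -
  let ?W = "verts \<G>" and ?S = "verts (\<G> - {(a, b, c)})"
  have finG: "finite \<G>" using \<G> by (simp add: cherry_join_def)
  have ch: "cherry (a, b, c)" using \<G> g unfolding cherry_join_def by blast
  have H: "cherry_join (\<G> - {(a, b, c)})" using \<G> by (rule cherry_join_subset) auto
  have "card ?S = 3 * (card \<G> - 1)" using card_verts[OF H] g finG by simp
  moreover have "card \<G> > 0" using g finG card_gt_0_iff by blast
  ultimately have cS: "odd (card ?S) \<longleftrightarrow> even (card \<G>)" by (cases "card \<G>") auto
  have fin: "finite ?W" using finite_verts[OF \<G>] .
  have sub: "?S \<subseteq> ?W" by (auto intro!: verts_mono)
  have W: "?W - ?S = {a, b, c}" using verts_Diff[OF \<G>, of "\<G> - {(a, b, c)}"] g by (simp add: double_diff)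
  have adj: "{u, v} \<in> E" if "u \<in> ?S" "v \<in> {a, b, c}" for u v
  proof -
    from that(1) obtain h where h: "h \<in> \<G>" "h \<noteq> (a, b, c)" "u \<in> tset h"
      unfolding verts_def by blast
    then have "joined h (a, b, c)" using \<G> g unfolding cherry_join_def by blast
    moreover have "v \<in> tset (a, b, c)" using that(2) by simp
    ultimately show ?thesis using h(3) unfolding joined_def by blast
  qed
  have od: "odd_deg ?W v \<longleftrightarrow> odd_deg {a, b, c} v \<noteq> odd (card ?S)" if "v \<in> {a, b, c}" for v
    using odd_deg_Diff[OF fin sub, of v] nb_eq_self[of ?S v] adj that unfolding W by auto
  have "nb {a, b, c} a = {c}" "nb {a, b, c} b = {}" "nb {a, b, c} c = {a}"
    using ch no_loop by (auto simp: nb_def insert_commute)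
  then have "odd_deg {a, b, c} a" "\<not> odd_deg {a, b, c} b" "odd_deg {a, b, c} c"
    by (auto simp: odd_deg_def)
  then show "odd_deg (verts \<G>) a \<longleftrightarrow> odd (card \<G>)" "odd_deg (verts \<G>) b \<longleftrightarrow> even (card \<G>)"
    "odd_deg (verts \<G>) c \<longleftrightarrow> odd (card \<G>)"
    using od[of a] od[of b] od[of c] cS by auto
qed

lemma cherry_join_adj:
  assumes "cherry_join \<G>" "g \<in> \<G>" "h \<in> \<G>" "g \<noteq> h" "x \<in> tset g" "y \<in> tset h"
  shows "{x, y} \<in> E" "x \<noteq> y"
proof -
  have "joined g h" using assms unfolding cherry_join_def by blast
  then show "{x, y} \<in> E" using assms(5,6) unfolding joined_def by blast
  then show "x \<noteq> y" by (rule edge_neq)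
qed

text \<open>
  With an even number of cherries, one of them can be removed alone. With an odd number, after
  deleting the middle vertex of one cherry its two ends each absorb a further cherry.
\<close>
lemma even_dec_cherry_join:
  assumes "cherry_join \<G>" "even_edges (verts \<G>)"
  shows "even_dec E (verts \<G>)"
  using assms
proof (induction "card \<G>" arbitrary: \<G> rule: less_induct)
  case less
  note \<G> = less.prems(1)
  have finG: "finite \<G>" using \<G> by (simp add: cherry_join_def)
  let ?W = "verts \<G>"
  have fin: "finite ?W" using finite_verts[OF \<G>] .
  have IH: ?case if "\<H> \<subseteq> \<G>" "\<H> \<noteq> {}" "red ?W (verts (\<G> - \<H>))" for \<H>
  proof -
    have "card (\<G> - \<H>) < card \<G>" using that(1,2) finG by (intro psubset_card_mono) auto
    moreover have "cherry_join (\<G> - \<H>)" using \<G> by (rule cherry_join_subset) auto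
    ultimately show ?thesis using less.hyps that(3) less.prems(2) unfolding red_def by blast
  qed
  show ?case
  proof (cases "\<G> = {}")
    case True
    then show ?thesis by (auto intro: even_dec.empty)
  next
    case False
    then obtain a b c where g: "(a, b, c) \<in> \<G>" by (metis all_not_in_conv prod_cases3)
    have ch: "cherry (a, b, c)" using \<G> g unfolding cherry_join_def by blast
    have abc: "a \<in> ?W" "b \<in> ?W" "c \<in> ?W" using tset_subset_verts[OF g] by auto
    note deg = odd_deg_cherry_join[OF \<G> g]
    show ?thesis
    proof (cases "even (card \<G>)")
      case True
      \<comment> \<open>All ends are even and all middles odd. Deleting \<open>a\<close> turns
        \<open>c\<close> odd and leaves \<open>b\<close> odd, and these two are not
        adjacent.\<close>
      have "red ?W (?W - {a})" using red_even[OF fin abc(1)] deg True by simp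
      also have "red (?W - {a}) (?W - {a} - {b} - {c})"
        using fin abc ch deg True by (intro red_odd_pair) (auto simp: odd_deg_remove)
      finally have "red ?W (?W - {a} - {b} - {c})" .
      moreover have "?W - {a} - {b} - {c} = verts (\<G> - {(a, b, c)})"

      proof -
        have "?W - {a} - {b} - {c} = ?W - {a, b, c}" by blast
        then show ?thesis using verts_Diff[OF \<G>, of "{(a, b, c)}"] g by simp
      qed
      ultimately show ?thesis using IH[of "{(a, b, c)}"] g by simp
    next
      case odd: False
      have b: "red ?W (?W - {b})" using red_even[OF fin abc(2)] deg odd by simp
      show ?thesis
      proof (cases "card \<G> = 1")
        case True
        \<comment> \<open>A single cherry has exactly one edge, so this case contradicts
          evenness.\<close>
        then have "\<G> = {(a, b, c)}" using g by (auto simp: card_1_singleton_iff)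
        then have W: "?W = {a, b, c}" by auto
        have "odd_deg (?W - {b}) a" using deg odd ch fin abc by (simp add: odd_deg_remove insert_commute)
        then have "\<not> even_edges (?W - {b} - {a}) \<longleftrightarrow> even_edges (?W - {b})"
          using even_edges_remove[of "?W - {b}" a] fin abc ch by auto
        moreover have "?W - {b} - {a} = {c}" using W ch by auto
        moreover have "induced_edges E {c} = {}"
        proof -
          have False if "e \<in> E" "e \<subseteq> {c}" for e
            using card_edge[OF that(1)] card_mono[OF _ that(2)] by simp
          then show ?thesis unfolding induced_edges_def by blast
        qed
        ultimately have "\<not> even_edges (?W - {b})" by (simp add: even_edges_def)
        then show ?thesis using b less.prems(2) by (simp add: red_def)
      next
        case False
        then have "card \<G> \<ge> 3" using odd by presburger
        then have "card (\<G> - {(a, b, c)}) \<ge> 2" using g finG by simp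
        then obtain \<S> where "\<S> \<subseteq> \<G> - {(a, b, c)}" "card \<S> = 2" using obtain_subset_with_card_n by metis
        then obtain g1 g2 where g12: "g1 \<in> \<G>" "g2 \<in> \<G>" "g1 \<noteq> g2" "g1 \<noteq> (a, b, c)" "g2 \<noteq> (a, b, c)"
          by (auto simp: card_2_iff)
        obtain x y z where g1: "g1 = (x, y, z)" by (cases g1)
        obtain x' y' z' where g2: "g2 = (x', y', z')" by (cases g2)
        have adj1: "{a, v} \<in> E" "{b, v} \<in> E" "{c, v} \<in> E" "v \<noteq> a" "v \<noteq> b" "v \<noteq> c" if "v \<in> {x, y, z}" for v
          using cherry_join_adj[OF \<G> g g12(1), of _ v] g12 that g1 by auto
        have adj2: "{a, v} \<in> E" "{b, v} \<in> E" "{c, v} \<in> E" "v \<noteq> a" "v \<noteq> b" "v \<noteq> c" if "v \<in> {x', y', z'}" for v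
          using cherry_join_adj[OF \<G> g g12(2), of _ v] g12 that g2 by auto
        have adj12: "{u, v} \<in> E" "u \<noteq> v" if "u \<in> {x, y, z}" "v \<in> {x', y', z'}" for u v
          using cherry_join_adj[OF \<G> g12(1,2,3), of u v] that g1 g2 by auto
        have ch12: "cherry (x, y, z)" "cherry (x', y', z')" using \<G> g12 g1 g2 by (auto simp: cherry_join_def)
        have mem: "{x, y, z} \<subseteq> ?W" "{x', y', z'} \<subseteq> ?W"
          using tset_subset_verts[OF g12(1)] tset_subset_verts[OF g12(2)] g1 g2 by simp_all
        note deg1 = odd_deg_cherry_join[OF \<G> g12(1)[unfolded g1]]
        note deg2 = odd_deg_cherry_join[OF \<G> g12(2)[unfolded g2]]
        let ?W1 = "?W - {b}"
        let ?W2 = "?W1 - {a} - {x, y, z}"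
        \<comment> \<open>Deleting \<open>b\<close> makes the ends of every other cherry even and
          its middle odd, so the three parities have the odd sum that a joined cherry needs.\<close>
        have r1: "red ?W1 ?W2"
        proof (rule joined_cherry_eats)
          show "{x, y, z} \<subseteq> ?W1" "a \<in> ?W1" "a \<notin> {x, y, z}" using mem adj1 ch abc by auto
          show "odd_deg ?W1 a" using deg odd ch fin abc by (simp add: odd_deg_remove insert_commute)
          show "odd_deg ?W1 x \<noteq> (odd_deg ?W1 y \<noteq> odd_deg ?W1 z)"
            using fin abc deg1 odd adj1 by (simp add: odd_deg_remove)
        qed (use fin ch12 adj1 in auto)
        \<comment> \<open>Four vertices adjacent to \<open>v\<close> disappear, which leaves its
          parity unchanged; hence the same argument applies to \<open>c\<close> and the second
          cherry.\<close>
        have od: "odd_deg ?W2 v \<longleftrightarrow> odd_deg ?W1 v" if "{a, v} \<in> E" "\<forall>u\<in>{x, y, z}. {u, v} \<in> E" for v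
        proof -
          have "?W2 = ?W1 - {a, x, y, z}" by auto
          moreover have "nb {a, x, y, z} v = {a, x, y, z}" using that by (intro nb_eq_self) auto
          moreover have "card {a, x, y, z} = 4" using ch12 adj1[of x] adj1[of y] adj1[of z] by auto
          ultimately show ?thesis using odd_deg_Diff[of ?W1 "{a, x, y, z}" v] fin abc mem adj1 ch by auto
        qed
        have r2: "red ?W2 (?W2 - {c} - {x', y', z'})"
        proof (rule joined_cherry_eats)
          have "v \<in> ?W2" if v: "v \<in> {x', y', z'}" for v
            using subsetD[OF mem(2) v] adj2(4,5)[OF v] adj12(2)[OF _ v] by blast
          then show "{x', y', z'} \<subseteq> ?W2" by blast
          show "c \<notin> {x', y', z'}" using adj2(6) by blast
          have "c \<noteq> a" "c \<noteq> b" "c \<notin> {x, y, z}" using adj1(6) ch by auto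
          then show "c \<in> ?W2" using abc(3) by blast
          have "odd_deg ?W1 c" using deg odd ch fin abc by (simp add: odd_deg_remove insert_commute)
          show "odd_deg ?W2 c"
          proof -
            have "\<forall>u\<in>{x, y, z}. {u, c} \<in> E" using adj1(3) by (metis insert_commute)
            moreover have "{a, c} \<in> E" using ch by simp
            ultimately show ?thesis using od \<open>odd_deg ?W1 c\<close> by blast
          qed
          have "odd_deg ?W2 v \<longleftrightarrow> odd_deg ?W1 v" if "v \<in> {x', y', z'}" for v
            using od[OF adj2(1)[OF that]] adj12(1)[OF _ that] by blast
          then show "odd_deg ?W2 x' \<noteq> (odd_deg ?W2 y' \<noteq> odd_deg ?W2 z')"
            using fin abc deg2 odd adj2 by (simp add: odd_deg_remove)
        qed (use fin ch12 adj2 in auto)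
        have "?W2 - {c} - {x', y', z'} = ?W - verts {(a, b, c), g1, g2}" using g1 g2 by auto
        also have "\<dots> = verts (\<G> - {(a, b, c), g1, g2})" using g g12 by (intro verts_Diff[OF \<G>]) simp
        finally have eq: "?W2 - {c} - {x', y', z'} = verts (\<G> - {(a, b, c), g1, g2})" .
        have "red ?W (verts (\<G> - {(a, b, c), g1, g2}))"
          using red_trans[OF red_trans[OF b r1] r2] unfolding eq .
        then show ?thesis using IH[of "{(a, b, c), g1, g2}"] g g12 by simp
      qed
    qed
  qed
qed

text \<open>Since 22 exceeds \<open>2 + 2 * 9\<close>, the cherries cannot run down to two before a
  set of at most nine vertices is gone. Against a larger set, either ten or more of its vertices go
  and at most six cherry vertices stay, or the set disappears and the cherries dissolve to at most
  nine vertices.\<close>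

lemma absorber_cherry_join:
  assumes \<G>: "cherry_join \<G>" and c: "card \<G> = 22"
  shows "absorber 9 (verts \<G>)"
  unfolding absorber_def
proof (intro conjI allI impI)
  let ?T = "verts \<G>"
  show "finite ?T" using finite_verts[OF \<G>] .
  show "?T \<noteq> {}" using card_verts[OF \<G>] c by auto
  fix K R assume fin: "finite K" "finite R" and disj: "K \<inter> ?T = {}" "K \<inter> R = {}" "?T \<inter> R = {}"
  obtain K1 \<G>1 where K1: "K1 \<subseteq> K" "\<G>1 \<subseteq> \<G>" "red (K \<union> ?T \<union> R) (K1 \<union> verts \<G>1 \<union> R)"
    "K1 = {} \<or> card \<G>1 \<le> 2" "card \<G> + 2 * card K1 \<le> card \<G>1 + 2 * card K"
    using cherries_eat[OF \<G> fin disj] by blast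
  have G1: "cherry_join \<G>1" using \<G> K1(2) by (rule cherry_join_subset)
  have sub: "verts \<G>1 \<subseteq> ?T" using K1(2) by (rule verts_mono)
  show "\<exists>K'\<subseteq>K \<union> ?T. card K' \<le> max (card K - 1) 9 \<and> red (K \<union> ?T \<union> R) (K' \<union> R)"
  proof (cases "card \<G>1 \<le> 2")
    case True
    then have "card K1 + 10 \<le> card K" "card (verts \<G>1) \<le> 6"
      using K1(5) c card_verts[OF G1] by auto
    then have "card (K1 \<union> verts \<G>1) \<le> card K - 1"
      using card_Un_le[of K1 "verts \<G>1"] by linarith
    then show ?thesis using K1(1,3) sub by (intro exI[of _ "K1 \<union> verts \<G>1"]) auto
  next
    case False
    then have "K1 = {}" using K1(4) by simp
    have "verts \<G>1 \<inter> R = {}" using sub disj(3) by blast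
    then obtain K' where K': "K' \<subseteq> verts \<G>1" "card K' \<le> 9" "red (verts \<G>1 \<union> R) (K' \<union> R)"
      using cherries_dissolve[OF G1 fin(2)] by blast
    then show ?thesis using red_trans[OF K1(3)] \<open>K1 = {}\<close> sub by (intro exI[of _ K']) auto
  qed
next
  let ?T = "verts \<G>"
  fix K assume K: "finite K" "K \<inter> ?T = {}" "card K \<le> 9" "even_edges (K \<union> ?T)"
  obtain K1 \<G>1 where K1: "K1 \<subseteq> K" "\<G>1 \<subseteq> \<G>" "red (K \<union> ?T \<union> {}) (K1 \<union> verts \<G>1 \<union> {})"
    "K1 = {} \<or> card \<G>1 \<le> 2" "card \<G> + 2 * card K1 \<le> card \<G>1 + 2 * card K"
    using cherries_eat[OF \<G> K(1), of "{}"] K(2) by blast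
  have G1: "cherry_join \<G>1" using \<G> K1(2) by (rule cherry_join_subset)
  have "K1 = {}" using K1(4,5) c K(3) by auto
  then show "even_dec E (K \<union> ?T)" using K1(3) K(4) even_dec_cherry_join[OF G1] by (simp add: red_def)
qed

theorem absorber_cherry:
  assumes "copy cherry_pattern 66 f"
  shows "absorber 9 (f ` {..<66})"
proof -
  define tri where "tri = (\<lambda>i. (f (3 * i), f (3 * i + 1), f (3 * i + 2)))"
  have inj: "f i = f j \<longleftrightarrow> i = j" if "i < 66" "j < 66" for i j
    using assms that unfolding copy_def by (auto simp: inj_on_eq_iff)
  have adj: "{f i, f j} \<in> E \<longleftrightarrow> cherry_pattern i j" if "i < 66" "j < 66" "i \<noteq> j" for i j
    using assms that unfolding copy_def by blast
  have mem: "x \<in> tset (tri i) \<longleftrightarrow> (\<exists>r<3. x = f (3 * i + r))" for x i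
  proof -
    have "{..<3} = {0, 1, 2::nat}" by auto
    then have "(\<exists>r<3. x = f (3 * i + r)) \<longleftrightarrow> (\<exists>r\<in>{0, 1, 2}. x = f (3 * i + r))" by blast
    then show ?thesis unfolding tri_def by simp
  qed
  have inj_tri: "inj_on tri {..<22}"
  proof (rule inj_onI)
    fix i j :: nat assume "i \<in> {..<22}" "j \<in> {..<22}" "tri i = tri j"
    then show "i = j" using inj[of "3 * i" "3 * j"] unfolding tri_def by simp
  qed
  have "cherry_join (tri ` {..<22})" unfolding cherry_join_def
  proof (intro conjI ballI impI)
    show "cherry g" if g: "g \<in> tri ` {..<22}" for g
    proof -
      obtain i where i: "i < 22" "g = tri i" using g by auto
      have "(3 * i) div 3 = i" "(3 * i + 1) div 3 = i" "(3 * i + 2) div 3 = i"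
        "(3 * i) mod 3 = 0" "(3 * i + 1) mod 3 = 1" "(3 * i + 2) mod 3 = 2" by presburger+
      then show ?thesis
        using i inj[of "3 * i" "3 * i + 1"] inj[of "3 * i" "3 * i + 2"] inj[of "3 * i + 1" "3 * i + 2"]
          adj[of "3 * i" "3 * i + 1"] adj[of "3 * i" "3 * i + 2"] adj[of "3 * i + 1" "3 * i + 2"]
        unfolding tri_def cherry_pattern_def by simp
    qed
    fix g h assume "g \<in> tri ` {..<22}" "h \<in> tri ` {..<22}" "g \<noteq> h"
    then obtain i j where ij: "i < 22" "j < 22" "i \<noteq> j" "g = tri i" "h = tri j" by auto
    have *: "{f (3 * i + r), f (3 * j + s)} \<in> E" "f (3 * i + r) \<noteq> f (3 * j + s)" if "r < 3" "s < 3" for r s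
    proof -
      have "(3 * i + r) div 3 = i" "(3 * j + s) div 3 = j" using that by auto
      then have "cherry_pattern (3 * i + r) (3 * j + s)" "3 * i + r \<noteq> 3 * j + s"
        using ij(3) unfolding cherry_pattern_def by auto
      then show "{f (3 * i + r), f (3 * j + s)} \<in> E" "f (3 * i + r) \<noteq> f (3 * j + s)"
        using adj[of "3 * i + r" "3 * j + s"] inj[of "3 * i + r" "3 * j + s"] ij(1,2) that by auto
    qed
    show "tset g \<inter> tset h = {}"
    proof (rule equals0I)
      fix x assume "x \<in> tset g \<inter> tset h"
      then obtain r s where "r < 3" "s < 3" "x = f (3 * i + r)" "x = f (3 * j + s)"
        using mem[of x i] mem[of x j] ij(4,5) by auto
      then show False using *(2)[of r s] by simp
    qed
    show "joined g h" unfolding joined_def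
    proof (intro ballI)
      fix x y assume "x \<in> tset g" "y \<in> tset h"
      then obtain r s where "r < 3" "s < 3" "x = f (3 * i + r)" "y = f (3 * j + s)"
        using mem[of x i] mem[of y j] ij(4,5) by auto
      then show "{x, y} \<in> E" using *(1)[of r s] by simp
    qed
  qed simp
  moreover have "card (tri ` {..<22}) = 22" using card_image[OF inj_tri] by simp
  moreover have "verts (tri ` {..<22}) = f ` {..<66}"
  proof -
    have "\<exists>j\<in>{..<22}. \<exists>r\<in>{..<3}. i = 3 * j + r" if "i < 66" for i :: nat
    proof -
      have "i div 3 \<in> {..<22}" "i mod 3 \<in> {..<3}" "i = 3 * (i div 3) + i mod 3" using that by simp_all
      then show ?thesis by blast
    qed
    then have "{..<66} \<subseteq> (\<Union>j\<in>{..<22}. (\<lambda>r. 3 * j + r) ` {..<3::nat})" by blast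
    moreover have "(\<Union>j\<in>{..<22}. (\<lambda>r. 3 * j + r) ` {..<3::nat}) \<subseteq> {..<66}" by auto
    ultimately have idx: "{..<66} = (\<Union>j\<in>{..<22}. (\<lambda>r. 3 * j + r) ` {..<3::nat})" by (rule equalityI)
    have "tset (tri i) = f ` (\<lambda>r. 3 * i + r) ` {..<3}" for i using mem by auto
    then show ?thesis unfolding verts_def idx by (simp add: image_UN)
  qed
  ultimately show ?thesis using absorber_cherry_join by metis
qed

end

section \<open>Deterministic criteria for even-decomposability\<close>

text \<open>The first \<open>i\<close> sets cover at most \<open>f * i\<close> vertices, so the
  hypothesis still applies to the rest; non-emptiness makes each new set different from the earlier
  ones.\<close>

lemma disjoint_family_greedy:
  assumes "finite V" "\<And>R. R \<subseteq> V \<Longrightarrow> card V \<le> card R + f * r \<Longrightarrow> \<exists>T\<subseteq>R. P T \<and> T \<noteq> {} \<and> card T \<le> f"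
  shows "\<exists>\<F>. finite \<F> \<and> card \<F> = r \<and> pairwise disjnt \<F> \<and> (\<forall>T\<in>\<F>. P T \<and> T \<subseteq> V)"
proof -
  have "\<exists>\<F>. finite \<F> \<and> card \<F> = i \<and> pairwise disjnt \<F> \<and> (\<forall>T\<in>\<F>. P T \<and> T \<subseteq> V) \<and> card (\<Union>\<F>) \<le> f * i"
    if "i \<le> r" for i
    using that
  proof (induction i)
    case 0
    then show ?case by (intro exI[of _ "{}"]) auto
  next
    case (Suc i)
    then obtain \<F> where F: "finite \<F>" "card \<F> = i" "pairwise disjnt \<F>" "\<forall>T\<in>\<F>. P T \<and> T \<subseteq> V"
      "card (\<Union>\<F>) \<le> f * i" by auto
    have sub: "\<Union>\<F> \<subseteq> V" using F(4) by blast
    have "f * i \<le> f * r" using Suc.prems by simp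
    then have "card V \<le> card (V - \<Union>\<F>) + f * r"
      using F(5) card_Diff_subset[OF finite_subset[OF sub assms(1)] sub] by linarith
    then obtain T where T: "T \<subseteq> V - \<Union>\<F>" "P T" "T \<noteq> {}" "card T \<le> f"
      using assms(2)[of "V - \<Union>\<F>"] by blast
    have "T \<notin> \<F>" using T by blast
    moreover have "\<And>S. S \<in> \<F> \<Longrightarrow> disjnt T S" using T(1) by (auto simp: disjnt_def)
    moreover have "card (\<Union>(insert T \<F>)) \<le> f * Suc i"
      using card_Un_le[of T "\<Union>\<F>"] T(4) F(5) by simp
    ultimately show ?case using F T
      by (intro exI[of _ "insert T \<F>"]) (auto simp: pairwise_insert disjnt_sym)
  qed
  then show ?thesis by blast
qed

text \<open>After each block the closed \<open>h\<close>-neighbourhoods of all chosen vertices are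
  discarded, at most \<open>D + 1\<close> vertices for each, so later blocks are unrelated to
  earlier ones. Here \<open>h\<close> stands for adjacency in sparse graphs and for non-adjacency in
  dense ones.\<close>

lemma block_copies:
  fixes h :: "'a \<Rightarrow> 'a \<Rightarrow> bool"
  assumes "finite R" and sym: "\<And>u v. h u v \<longleftrightarrow> h v u" and b: "b > 0"
    and deg: "\<And>v. v \<in> R \<Longrightarrow> card {u \<in> R. h v u} \<le> D"
    and block: "\<And>Y. Y \<subseteq> R \<Longrightarrow> m \<le> card Y \<Longrightarrow> \<exists>g. inj_on g {..<b} \<and> g ` {..<b} \<subseteq> Y \<and>
      (\<forall>i<b. \<forall>j<b. i \<noteq> j \<longrightarrow> h (g i) (g j) = B i j)"
    and "m + b * s * (D + 1) \<le> card R"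
  shows "\<exists>f. inj_on f {..<b * s} \<and> f ` {..<b * s} \<subseteq> R \<and>
    (\<forall>i<b * s. \<forall>j<b * s. i \<noteq> j \<longrightarrow> h (f i) (f j) = (i div b = j div b \<and> B (i mod b) (j mod b)))"
  using assms(6)
proof (induction s)
  case 0
  then show ?case by auto
next
  case (Suc s)
  then obtain f where f: "inj_on f {..<b * s}" "f ` {..<b * s} \<subseteq> R"
    "\<forall>i<b * s. \<forall>j<b * s. i \<noteq> j \<longrightarrow> h (f i) (f j) = (i div b = j div b \<and> B (i mod b) (j mod b))"
    by (auto simp: algebra_simps)
  let ?X = "f ` {..<b * s}"
  let ?N = "\<Union>v\<in>?X. insert v {u \<in> R. h v u}"
  have "card (insert v {u \<in> R. h v u}) \<le> D + 1" if "v \<in> ?X" for v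
    using deg[of v] that f(2) assms(1) card_insert_le_m1[of "D + 1"] by (simp add: card_insert_if subset_iff)
  then have "card ?N \<le> card ?X * (D + 1)"
    using card_UN_le[of ?X "\<lambda>v. insert v {u \<in> R. h v u}"]
      sum_bounded_above[of ?X "\<lambda>v. card (insert v {u \<in> R. h v u})" "D + 1"] by fastforce
  then have cN: "card ?N \<le> b * s * (D + 1)" using card_image[OF f(1)] by simp
  have finN: "finite ?N" using assms(1) by auto
  have "m \<le> card (R - ?N)"
    using Suc.prems cN diff_card_le_card_Diff[OF finN, of R] by (simp add: algebra_simps)
  then obtain g where g: "inj_on g {..<b}" "g ` {..<b} \<subseteq> R - ?N"
    "\<forall>i<b. \<forall>j<b. i \<noteq> j \<longrightarrow> h (g i) (g j) = B i j"
    using block[of "R - ?N"] by blast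
  define f' where "f' = (\<lambda>i. if i < b * s then f i else g (i - b * s))"
  have split: "i < b * s \<or> (\<exists>r<b. i = b * s + r)" if "i < b * Suc s" for i
    using that by (cases "i < b * s") (auto intro: exI[of _ "i - b * s"])
  have f'1: "f' i = f i" if "i < b * s" for i using that by (simp add: f'_def)
  have f'2: "f' (b * s + r) = g r" for r by (simp add: f'_def)
  have cross: "f i \<noteq> g r" "\<not> h (f i) (g r)" "\<not> h (g r) (f i)" if "i < b * s" "r < b" for i r
  proof -
    have "g r \<in> R - ?N" "f i \<in> ?X" using that g(2) by auto
    then show "f i \<noteq> g r" "\<not> h (f i) (g r)" by auto
    then show "\<not> h (g r) (f i)" using sym by blast
  qed
  have dm: "(b * s + r) div b = s" "(b * s + r) mod b = r" if "r < b" for r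
    using that b by auto
  have lt: "i div b < s" if "i < b * s" for i
    using that b by (simp add: less_mult_imp_div_less mult.commute)
  show ?case
  proof (intro exI[of _ f'] conjI allI impI)
    show "inj_on f' {..<b * Suc s}"
    proof (rule inj_onI)
      fix i j assume ij: "i \<in> {..<b * Suc s}" "j \<in> {..<b * Suc s}" "f' i = f' j"
      then consider "i < b * s" "j < b * s" | r where "i < b * s" "j = b * s + r" "r < b"
        | r where "j < b * s" "i = b * s + r" "r < b"
        | r q where "i = b * s + r" "r < b" "j = b * s + q" "q < b"
        using split[of i] split[of j] by auto
      then show "i = j"
      proof cases
        case 1
        then show ?thesis using ij(3) f(1) by (auto simp: f'1 inj_on_def)
      next
        case 2
        then show ?thesis using ij(3) cross(1) by (simp add: f'1 f'2)
      next
        case 3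
        then show ?thesis using ij(3) cross(1) by (metis f'1 f'2)
      next
        case 4
        then show ?thesis using ij(3) g(1) by (auto simp: f'2 inj_on_def)
      qed
    qed
    show "f' ` {..<b * Suc s} \<subseteq> R"
    proof
      fix x assume "x \<in> f' ` {..<b * Suc s}"
      then obtain i where i: "i < b * Suc s" "x = f' i" by auto
      from split[OF i(1)] show "x \<in> R"
      proof
        assume "i < b * s"
        then show ?thesis using i f(2) by (auto simp: f'1)
      next
        assume "\<exists>r<b. i = b * s + r"
        then show ?thesis using i g(2) by (auto simp: f'2)
      qed
    qed
    fix i j assume ij: "i < b * Suc s" "j < b * Suc s" "i \<noteq> j"
    then consider "i < b * s" "j < b * s" | r where "i < b * s" "j = b * s + r" "r < b"
        | r where "j < b * s" "i = b * s + r" "r < b"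
        | r q where "i = b * s + r" "r < b" "j = b * s + q" "q < b"
      using split[of i] split[of j] by auto
    then show "h (f' i) (f' j) = (i div b = j div b \<and> B (i mod b) (j mod b))"
    proof cases
      case 1
      then show ?thesis using ij(3) f(3) by (simp add: f'1)
    next
      case 2
      then show ?thesis using cross(2) lt[of i] by (auto simp: f'1 f'2 dm)
    next
      case 3
      then show ?thesis using cross(3) lt[of j] by (auto simp: f'1 f'2 dm)
    next
      case 4
      then show ?thesis using g(3) ij(3) by (simp add: f'2 dm)
    qed
  qed
qed

text \<open>
  Otherwise \<open>h\<close> is a disjoint union of small cliques on \<open>Y\<close>, and grouping them splits \<open>Y\<close> into two
  large parts without \<open>h\<close>-edges between them.
\<close>
lemma ex_induced_path:
  fixes h :: "'a \<Rightarrow> 'a \<Rightarrow> bool"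
  assumes "finite Y" and sym: "\<And>u v. h u v \<longleftrightarrow> h v u"
    and deg: "\<And>v. v \<in> Y \<Longrightarrow> card {u \<in> Y. h v u} \<le> D"
    and edge: "\<And>A B. A \<subseteq> Y \<Longrightarrow> B \<subseteq> Y \<Longrightarrow> A \<inter> B = {} \<Longrightarrow> d \<le> card A \<Longrightarrow> d \<le> card B \<Longrightarrow> \<exists>a\<in>A. \<exists>b\<in>B. h a b"
    and card: "2 * d + 2 * D + 2 \<le> card Y"
  shows "\<exists>a\<in>Y. \<exists>b\<in>Y. \<exists>c\<in>Y. a \<noteq> b \<and> b \<noteq> c \<and> a \<noteq> c \<and> h a b \<and> h b c \<and> \<not> h a c"
proof (rule ccontr)
  assume "\<not> ?thesis"
  then have tr: "h a c" if "a \<in> Y" "b \<in> Y" "c \<in> Y" "h a b" "h b c" "a \<noteq> b" "b \<noteq> c" "a \<noteq> c" for a b c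
    using that by blast
  define closed where "closed U \<longleftrightarrow> (\<forall>u\<in>U. \<forall>v\<in>Y - U. \<not> h u v)" for U
  define \<U> where "\<U> = {U. U \<subseteq> Y \<and> closed U \<and> 2 * card U \<le> card Y}"
  have fin: "finite \<U>" unfolding \<U>_def using assms(1) by auto
  have "{} \<in> \<U>" unfolding \<U>_def closed_def by simp
  \<comment> \<open>A closed set is a union of components of \<open>h\<close>. A largest one within
    half of \<open>Y\<close> has fewer than \<open>d\<close> vertices, as otherwise
    \<open>edge\<close> would yield an \<open>h\<close>-edge leaving it.\<close>
  then obtain U where U: "U \<in> \<U>" "\<And>W. W \<in> \<U> \<Longrightarrow> card W \<le> card U"
  proof -
    have "Max (card ` \<U>) \<in> card ` \<U>" using fin \<open>{} \<in> \<U>\<close> by (intro Max_in) auto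
    then obtain U where "U \<in> \<U>" "card U = Max (card ` \<U>)" by auto
    then show thesis using fin by (intro that[of U]) simp_all
  qed
  have UY: "U \<subseteq> Y" "closed U" "2 * card U \<le> card Y" using U(1) by (auto simp: \<U>_def)
  have finU: "finite U" using UY(1) assms(1) finite_subset by blast
  have cYU: "card (Y - U) = card Y - card U" using card_Diff_subset[OF finU UY(1)] .
  have small: "card U < d"
  proof (rule ccontr)
    assume "\<not> card U < d"
    moreover have "d \<le> card (Y - U)" using cYU UY(3) card by linarith
    ultimately have "\<exists>a\<in>U. \<exists>b\<in>Y - U. h a b" using UY(1) by (intro edge) auto
    then show False using UY(2) unfolding closed_def by blast
  qed
  then have "card (Y - U) > 0" using cYU card by linarith
  then have "Y - U \<noteq> {}" by (metis card.empty less_irrefl)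
  then obtain v where v: "v \<in> Y" "v \<notin> U" by blast
  \<comment> \<open>By transitivity the component of \<open>v\<close> is its closed neighbourhood.
    Adding it keeps the set closed and of size at most \<open>d + D\<close>, which is at most half
    of \<open>Y\<close>, against maximality.\<close>
  define C where "C = insert v {u \<in> Y. h v u}"
  have "closed C" unfolding closed_def
  proof (intro ballI notI)
    fix x y assume xy: "x \<in> C" "y \<in> Y - C" "h x y"
    then have "x \<noteq> v" unfolding C_def by auto
    then have "h v x" "x \<in> Y" "x \<noteq> y" "y \<noteq> v" using xy unfolding C_def by auto
    then have "h v y" using tr[of v x y] xy v by blast
    then show False using xy unfolding C_def by auto
  qed
  then have "closed (U \<union> C)" using UY(2) unfolding closed_def by blast
  moreover have "card C \<le> D + 1" unfolding C_def using deg[OF v(1)] assms(1) by (simp add: card_insert_if)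
  then have "card (U \<union> C) \<le> d + D" using card_Un_le[of U C] small by linarith
  moreover have "U \<union> C \<subseteq> Y" using UY(1) v unfolding C_def by auto
  ultimately have "U \<union> C \<in> \<U>" using card unfolding \<U>_def by auto
  moreover have "card U < card (U \<union> C)"
    using v finU assms(1) by (intro psubset_card_mono) (auto simp: C_def)
  ultimately show False using U(2) by fastforce
qed

lemma ex_halves:
  assumes "2 * d \<le> card Y"
  shows "\<exists>A B. A \<subseteq> Y \<and> B \<subseteq> Y \<and> A \<inter> B = {} \<and> card A = d \<and> d \<le> card B"
proof (cases "finite Y")
  case True
  obtain A where A: "A \<subseteq> Y" "card A = d" using obtain_subset_with_card_n[of d Y] assms by auto
  have "card (Y - A) = card Y - d" using card_Diff_subset[OF finite_subset[OF A(1) True] A(1)] A(2) by simp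
  then show ?thesis using A assms by (intro exI[of _ A] exI[of _ "Y - A"]) auto
next
  case False
  \<comment> \<open>For infinite \<open>Y\<close> the cardinality is 0 by convention, so
    \<open>d = 0\<close>.\<close>
  then show ?thesis using assms by (intro exI[of _ "{}"]) auto
qed

section \<open>Criteria for sparse, dense and middle densities\<close>

context simple_graph
begin

lemma even_dec_criterion:
  assumes "finite V" "even_edges V" "r \<ge> 1" "\<And>K. K \<subseteq> V \<Longrightarrow> clique K \<Longrightarrow> card K < r + b"
    "\<And>R. R \<subseteq> V \<Longrightarrow> card V \<le> card R + f * r \<Longrightarrow> \<exists>T\<subseteq>R. absorber b T \<and> card T \<le> f"
  shows "even_dec E V"
proof -
  have "\<exists>\<F>. finite \<F> \<and> card \<F> = r \<and> pairwise disjnt \<F> \<and> (\<forall>T\<in>\<F>. absorber b T \<and> T \<subseteq> V)"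
  proof (rule disjoint_family_greedy[OF assms(1)])
    fix R assume R: "R \<subseteq> V" "card V \<le> card R + f * r"
    obtain T where T: "T \<subseteq> R" "absorber b T" "card T \<le> f" using assms(5)[OF R] by blast
    then have "T \<noteq> {}" by (simp add: absorber_def)
    with T show "\<exists>T\<subseteq>R. absorber b T \<and> T \<noteq> {} \<and> card T \<le> f" by blast
  qed
  then obtain \<F> where "finite \<F>" "card \<F> = r" "pairwise disjnt \<F>" "\<forall>T\<in>\<F>. absorber b T \<and> T \<subseteq> V" by blast
  then show ?thesis using assms(1-4) by (intro even_dec_of_absorbers[of V \<F> b]) auto
qed

text \<open>Cliques have at most \<open>D + 1\<close> vertices, so \<open>D + 1\<close> absorbers
  are enough. The vertex budget is \<open>12 * (D + 1)\<close> for absorbers already chosen, again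
  \<open>12 * (D + 1)\<close> for neighbourhoods discarded while building the next one, and
  \<open>2 * d\<close> for finding one more edge.\<close>

lemma even_dec_sparse:
  assumes fin: "finite V" and ev: "even_edges V"
    and deg: "\<And>v. v \<in> V \<Longrightarrow> card (nb V v) \<le> D"
    and edge: "\<And>A B. A \<subseteq> V \<Longrightarrow> B \<subseteq> V \<Longrightarrow> A \<inter> B = {} \<Longrightarrow> d \<le> card A \<Longrightarrow> d \<le> card B \<Longrightarrow>
      \<exists>a\<in>A. \<exists>b\<in>B. {a, b} \<in> E"
    and card: "2 * d + 24 * (D + 1) \<le> card V"
  shows "even_dec E V"
proof (rule even_dec_criterion[OF fin ev, of "D + 1" 2 12])
  show "card K < D + 1 + 2" if K: "K \<subseteq> V" "clique K" for K
  proof (cases "K = {}")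
    case False
    then obtain v where v: "v \<in> K" by blast
    have "K - {v} \<subseteq> nb V v" using K v unfolding clique_def nb_def by auto
    moreover have "finite (nb V v)" using fin nb_subset finite_subset by blast
    ultimately have "card (K - {v}) \<le> D" using card_mono deg[of v] v K(1) by (meson le_trans subsetD)
    then show ?thesis using card_Diff1_le[of K v] v by (simp add: card_Diff_singleton_if split: if_splits)
  qed simp
  fix R assume R: "R \<subseteq> V" "card V \<le> card R + 12 * (D + 1)"
  have finR: "finite R" using R(1) fin finite_subset by blast
  have "\<exists>f :: nat \<Rightarrow> 'a. inj_on f {..<2 * 6} \<and> f ` {..<2 * 6} \<subseteq> R \<and>
    (\<forall>i<2 * 6. \<forall>j<2 * 6. i \<noteq> j \<longrightarrow> ({f i, f j} \<in> E) = (i div 2 = j div 2 \<and> True))"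
  proof (rule block_copies[OF finR, where m = "2 * d" and D = D])
    show "{u, v} \<in> E \<longleftrightarrow> {v, u} \<in> E" for u v by (simp add: insert_commute)
    show "card {u \<in> R. {v, u} \<in> E} \<le> D" if "v \<in> R" for v
    proof -
      have "{u \<in> R. {v, u} \<in> E} \<subseteq> nb V v" using R(1) by (auto simp: nb_def insert_commute)
      moreover have "finite (nb V v)" using fin nb_subset finite_subset by blast
      ultimately show ?thesis using card_mono deg[of v] that R(1) by (meson le_trans subsetD)
    qed
    show "2 * d + 2 * 6 * (D + 1) \<le> card R" using R(2) card by simp
    fix Y assume Y: "Y \<subseteq> R" "2 * d \<le> card Y"
    obtain A B where AB: "A \<subseteq> Y" "B \<subseteq> Y" "A \<inter> B = {}" "card A = d" "d \<le> card B"
      using ex_halves[OF Y(2)] by blast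
    have "\<exists>a\<in>A. \<exists>b\<in>B. {a, b} \<in> E" using AB Y(1) R(1) by (intro edge) auto
    then obtain a b where "a \<in> A" "b \<in> B" "{a, b} \<in> E" by blast
    then show "\<exists>g :: nat \<Rightarrow> 'a. inj_on g {..<2} \<and> g ` {..<2} \<subseteq> Y \<and> (\<forall>i<2. \<forall>j<2. i \<noteq> j \<longrightarrow> ({g i, g j} \<in> E) = True)"
      using AB edge_neq[of a b] by (intro exI[of _ "\<lambda>i. if i = 0 then a else b"])
        (auto simp: inj_on_def less_2_cases_iff insert_commute split: if_splits)
  qed simp
  then obtain f :: "nat \<Rightarrow> 'a" where f: "copy matching_pattern 12 f" "f ` {..<12} \<subseteq> R"
    unfolding copy_def matching_pattern_def by auto
  have "card (f ` {..<12}) \<le> 12" using card_image_le[of "{..<12}" f] by simp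
  then show "\<exists>T\<subseteq>R. absorber 2 T \<and> card T \<le> 12" using absorber_matching[OF f(1)] f(2) by blast
qed simp

text \<open>A larger clique could be halved into two sets of size at least \<open>d\<close> without
  a non-edge between them.\<close>

lemma clique_card_less:
  assumes edge: "\<And>A B. A \<subseteq> V \<Longrightarrow> B \<subseteq> V \<Longrightarrow> A \<inter> B = {} \<Longrightarrow> d \<le> card A \<Longrightarrow> d \<le> card B \<Longrightarrow>
      \<exists>a\<in>A. \<exists>b\<in>B. {a, b} \<notin> E"
    and K: "K \<subseteq> V" "clique K"
  shows "card K < 2 * d"
proof (rule ccontr)
  assume "\<not> card K < 2 * d"
  then obtain A B where AB: "A \<subseteq> K" "B \<subseteq> K" "A \<inter> B = {}" "card A = d" "d \<le> card B"
    using ex_halves[of d K] by auto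
  then have "\<exists>a\<in>A. \<exists>b\<in>B. {a, b} \<notin> E" using K(1) by (intro edge) auto
  then obtain x y where xy: "x \<in> A" "y \<in> B" "{x, y} \<notin> E" by blast
  then have "x \<in> K" "y \<in> K" "x \<noteq> y" using AB(1-3) by auto
  then show False using xy(3) K(2) unfolding clique_def by simp
qed

text \<open>Here cliques are bounded through \<open>edge\<close>, so \<open>2 * d\<close> absorbers
  of 66 vertices are needed. The budget is \<open>132 * d\<close> for those already chosen,
  \<open>66 * (D + 1)\<close> for discarded neighbourhoods in the complement, and
  \<open>2 * d + 2 * D + 2\<close> for finding one more induced path there.\<close>

lemma even_dec_dense:
  assumes fin: "finite V" and ev: "even_edges V" and d: "d \<ge> 1"
    and deg: "\<And>v. v \<in> V \<Longrightarrow> card {u \<in> V. u \<noteq> v \<and> {u, v} \<notin> E} \<le> D"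
    and edge: "\<And>A B. A \<subseteq> V \<Longrightarrow> B \<subseteq> V \<Longrightarrow> A \<inter> B = {} \<Longrightarrow> d \<le> card A \<Longrightarrow> d \<le> card B \<Longrightarrow>
      \<exists>a\<in>A. \<exists>b\<in>B. {a, b} \<notin> E"
    and card: "134 * d + 68 * (D + 1) \<le> card V"
  shows "even_dec E V"
proof (rule even_dec_criterion[OF fin ev, of "2 * d" 9 66])
  show "card K < 2 * d + 9" if K: "K \<subseteq> V" "clique K" for K
  proof -
    have "card K < 2 * d" by (rule clique_card_less[OF _ K]) (rule edge)
    then show ?thesis by simp
  qed
  fix R assume R: "R \<subseteq> V" "card V \<le> card R + 66 * (2 * d)"
  have finR: "finite R" using R(1) fin finite_subset by blast
  define h where "h u v \<longleftrightarrow> u \<noteq> v \<and> {u, v} \<notin> E" for u v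
  have sym: "h u v \<longleftrightarrow> h v u" for u v unfolding h_def by (auto simp: insert_commute)
  have degY: "card {u \<in> Y. h v u} \<le> D" if "Y \<subseteq> R" "v \<in> Y" for Y v
  proof -
    have "{u \<in> Y. h v u} \<subseteq> {u \<in> V. u \<noteq> v \<and> {u, v} \<notin> E}"
      using that R(1) by (auto simp: h_def insert_commute)
    then have "card {u \<in> Y. h v u} \<le> card {u \<in> V. u \<noteq> v \<and> {u, v} \<notin> E}"
      using fin by (intro card_mono) auto
    then show ?thesis using deg[of v] that R(1) by auto
  qed
  have "\<exists>f :: nat \<Rightarrow> 'a. inj_on f {..<3 * 22} \<and> f ` {..<3 * 22} \<subseteq> R \<and>
    (\<forall>i<3 * 22. \<forall>j<3 * 22. i \<noteq> j \<longrightarrow> h (f i) (f j) = (i div 3 = j div 3 \<and> (i mod 3 = 1 \<or> j mod 3 = 1)))"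
  proof (rule block_copies[OF finR sym, where m = "2 * d + 2 * D + 2" and D = D])
    show "card {u \<in> R. h v u} \<le> D" if "v \<in> R" for v using degY that by blast
    show "2 * d + 2 * D + 2 + 3 * 22 * (D + 1) \<le> card R" using R(2) card by simp
    fix Y assume Y: "Y \<subseteq> R" "2 * d + 2 * D + 2 \<le> card Y"
    have "\<exists>a\<in>Y. \<exists>b\<in>Y. \<exists>c\<in>Y. a \<noteq> b \<and> b \<noteq> c \<and> a \<noteq> c \<and> h a b \<and> h b c \<and> \<not> h a c"
    proof (rule ex_induced_path[OF _ sym _ _ Y(2)])
      show "finite Y" using Y(1) finR finite_subset by blast
      show "\<exists>a\<in>A. \<exists>b\<in>B. h a b"
        if AB: "A \<subseteq> Y" "B \<subseteq> Y" "A \<inter> B = {}" "d \<le> card A" "d \<le> card B" for A B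
      proof -
        have "\<exists>a\<in>A. \<exists>b\<in>B. {a, b} \<notin> E" using AB Y(1) R(1) by (intro edge) auto
        then obtain x y where "x \<in> A" "y \<in> B" "{x, y} \<notin> E" by blast
        moreover from this AB(3) have "x \<noteq> y" by auto
        ultimately show ?thesis unfolding h_def by auto
      qed
    qed (use degY Y(1) in auto)
    then obtain a b c where "a \<in> Y" "b \<in> Y" "c \<in> Y" "a \<noteq> b" "b \<noteq> c" "a \<noteq> c" "h a b" "h b c" "\<not> h a c"
      by blast
    note abc = this
    define g where "g = (\<lambda>i::nat. if i = 0 then a else if i = 1 then b else c)"
    have g: "g 0 = a" "g 1 = b" "g 2 = c" by (simp_all add: g_def)
    have three: "{..<3} = {0, 1, 2::nat}" by auto
    have "inj_on g {..<3}" "g ` {..<3} \<subseteq> Y" unfolding three using abc g by auto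
    moreover have "\<forall>i\<in>{..<3}. \<forall>j\<in>{..<3}. i \<noteq> j \<longrightarrow> h (g i) (g j) = (i = 1 \<or> j = 1)"
      unfolding three using abc g sym[of b a] sym[of c b] sym[of c a] by simp
    ultimately show "\<exists>g :: nat \<Rightarrow> 'a. inj_on g {..<3} \<and> g ` {..<3} \<subseteq> Y \<and>
        (\<forall>i<3. \<forall>j<3. i \<noteq> j \<longrightarrow> h (g i) (g j) = (i = 1 \<or> j = 1))"
      by (intro exI[of _ g]) blast
  qed simp
  then obtain f :: "nat \<Rightarrow> 'a" where f: "inj_on f {..<66}" "f ` {..<66} \<subseteq> R"
    "\<And>i j. i < 66 \<Longrightarrow> j < 66 \<Longrightarrow> i \<noteq> j \<Longrightarrow> h (f i) (f j) = (i div 3 = j div 3 \<and> (i mod 3 = 1 \<or> j mod 3 = 1))"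
    by auto
  have "copy cherry_pattern 66 f" unfolding copy_def
  proof (intro conjI allI impI f(1))
    fix i j :: nat assume ij: "i < 66" "j < 66" "i \<noteq> j"
    have "f i \<noteq> f j" using f(1) ij by (auto simp: inj_on_eq_iff)
    then show "({f i, f j} \<in> E) = cherry_pattern i j"
      using f(3)[OF ij] unfolding h_def cherry_pattern_def by blast
  qed
  moreover have "card (f ` {..<66}) \<le> 66" using card_image_le[of "{..<66}" f] by simp
  ultimately show "\<exists>T\<subseteq>R. absorber 9 T \<and> card T \<le> 66" using absorber_cherry f(2) by blast
qed (use d in simp)

lemma even_dec_or_K4:
  assumes "finite V" "even_edges V" "\<not> even_dec E V"
  shows "\<exists>K\<subseteq>V. card K = 4 \<and> clique K"
proof -
  have "\<not> (\<forall>K\<subseteq>V. clique K \<longrightarrow> card K \<le> 3)"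
    using even_dec_of_small_cliques[OF assms(1,2)] assms(3) by blast
  then obtain K where K: "K \<subseteq> V" "clique K" "4 \<le> card K" by (auto simp: not_le Suc_le_eq)
  obtain L where "L \<subseteq> K" "card L = 4" using obtain_subset_with_card_n[OF K(3)] by blast
  then show ?thesis using K clique_subset by (intro exI[of _ L]) auto
qed

text \<open>Images are chosen from the highest index down. A vertex of \<open>X s\<close> is bad for
  \<open>j\<close> if its relation to \<open>X j\<close> is of the required kind too rarely;
  \<open>d\<close> bad vertices would contradict \<open>dense\<close>, so some vertex is good for
  every \<open>j\<close>. Each choice shrinks the other candidate sets by a factor of at least
  \<open>\<epsilon>\<close>, whence the power of \<open>\<epsilon>\<close>. The constant
  \<open>m\<close> stays fixed while \<open>s\<close> falls.\<close>

lemma embed_graph: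
  fixes F :: "nat \<Rightarrow> nat \<Rightarrow> bool" and \<epsilon> d :: real
  assumes fin: "finite V" and eps: "0 < \<epsilon>" "\<epsilon> \<le> 1" and d: "0 < d" and sym: "\<And>i j. F i j \<longleftrightarrow> F j i"
    and dense: "\<And>A B Q. A \<subseteq> V \<Longrightarrow> B \<subseteq> V \<Longrightarrow> A \<inter> B = {} \<Longrightarrow> d \<le> card A \<Longrightarrow> d \<le> card B \<Longrightarrow>
      \<epsilon> * card A * card B \<le> card {(a, b) \<in> A \<times> B. ({a, b} \<in> E) = Q}"
    and "\<And>i. i < s \<Longrightarrow> X i \<subseteq> V" "\<And>i j. i < s \<Longrightarrow> j < s \<Longrightarrow> i \<noteq> j \<Longrightarrow> X i \<inter> X j = {}"
    "\<And>i. i < s \<Longrightarrow> m * d \<le> \<epsilon> ^ s * card (X i)" "real s \<le> m"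
  shows "\<exists>f. (\<forall>i<s. f i \<in> X i) \<and> (\<forall>i<s. \<forall>j<s. i \<noteq> j \<longrightarrow> ({f i, f j} \<in> E) = F i j)"
  using assms(7-)
proof (induction s arbitrary: X)
  case 0
  then show ?case by simp
next
  case (Suc s)
  define bad where "bad j = {v \<in> X s. card {u \<in> X j. ({v, u} \<in> E) = F j s} < \<epsilon> * card (X j)}" for j
  have finX: "finite (X i)" if "i \<le> s" for i using Suc.prems(1)[of i] that fin finite_subset by auto
  have large: "m * d \<le> card (X i)" if "i \<le> s" for i
  proof -
    have "\<epsilon> ^ Suc s * card (X i) \<le> 1 * real (card (X i))"
      using eps by (intro mult_right_mono power_le_one) auto
    then show ?thesis using Suc.prems(3)[of i] that by simp
  qed
  have md: "d \<le> m * d" using Suc.prems(4) d by simp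
  have bad: "card (bad j) < d" if j: "j < s" for j
  proof (rule ccontr)
    assume "\<not> card (bad j) < d"
    then have big: "d \<le> card (bad j)" by simp
    have sub: "bad j \<subseteq> X s" unfolding bad_def by auto
    have finb: "finite (bad j)" using sub finX finite_subset by blast
    have ne: "bad j \<noteq> {}" using big d by auto
    have "\<epsilon> * card (bad j) * card (X j) \<le> card {(a, b) \<in> bad j \<times> X j. ({a, b} \<in> E) = F j s}"
    proof (rule dense)
      show "bad j \<inter> X j = {}" using Suc.prems(2)[of j s] sub j by auto
      show "bad j \<subseteq> V" "X j \<subseteq> V" using Suc.prems(1) sub j by (meson le_trans lessI less_SucI subset_trans)+
      show "d \<le> card (X j)" using large[of j] md j by simp
    qed (rule big)
    also have "{(a, b) \<in> bad j \<times> X j. ({a, b} \<in> E) = F j s} =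
        Sigma (bad j) (\<lambda>a. {b \<in> X j. ({a, b} \<in> E) = F j s})" by auto
    also have "real (card \<dots>) = (\<Sum>a\<in>bad j. real (card {b \<in> X j. ({a, b} \<in> E) = F j s}))"
      using finb finX j by (subst card_SigmaI) auto
    also have "\<dots> < (\<Sum>a\<in>bad j. \<epsilon> * card (X j))"
      by (rule sum_strict_mono[OF finb ne]) (simp add: bad_def)
    finally show False by (simp add: mult_ac)
  qed
  have "real (card (\<Union>j<s. bad j)) \<le> (\<Sum>j<s. real (card (bad j)))"
    using card_UN_le[of "{..<s}" bad] by (simp flip: of_nat_sum)
  also have "\<dots> \<le> (\<Sum>j<s. d)" using bad by (intro sum_mono) (simp add: less_imp_le)
  also have "\<dots> < m * d" using Suc.prems(4) d by simp
  also have "\<dots> \<le> card (X s)" by (rule large) simp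
  finally have "\<not> X s \<subseteq> (\<Union>j<s. bad j)"
    using card_mono[of "\<Union>j<s. bad j" "X s"] finX by (auto simp: bad_def)
  then obtain v where v: "v \<in> X s" "\<And>j. j < s \<Longrightarrow> v \<notin> bad j" by auto
  define Y where "Y j = {u \<in> X j. ({v, u} \<in> E) = F j s}" for j
  have Y: "\<epsilon> * card (X j) \<le> card (Y j)" if "j < s" for j
    using v(2)[OF that] v(1) unfolding bad_def Y_def by auto
  have "\<exists>f. (\<forall>i<s. f i \<in> Y i) \<and> (\<forall>i<s. \<forall>j<s. i \<noteq> j \<longrightarrow> ({f i, f j} \<in> E) = F i j)"
  proof (rule Suc.IH)
    show "Y i \<subseteq> V" if "i < s" for i using Suc.prems(1)[of i] that unfolding Y_def by auto
    show "Y i \<inter> Y j = {}" if "i < s" "j < s" "i \<noteq> j" for i j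
      using Suc.prems(2)[of i j] that unfolding Y_def by auto
    show "m * d \<le> \<epsilon> ^ s * card (Y i)" if "i < s" for i
    proof -
      have "m * d \<le> \<epsilon> ^ s * (\<epsilon> * card (X i))" using Suc.prems(3)[of i] that by (simp add: mult_ac)
      also have "\<dots> \<le> \<epsilon> ^ s * card (Y i)" using Y[OF that] eps by (intro mult_left_mono) auto
      finally show ?thesis .
    qed
    show "real s \<le> m" using Suc.prems(4) by simp
  qed
  then obtain f where f: "\<forall>i<s. f i \<in> Y i" "\<forall>i<s. \<forall>j<s. i \<noteq> j \<longrightarrow> ({f i, f j} \<in> E) = F i j" by blast
  have fv: "({v, f i} \<in> E) = F i s" "f i \<in> X i" if "i < s" for i
    using f(1) that unfolding Y_def by auto
  show ?case
  proof (intro exI[of _ "f(s := v)"] conjI allI impI)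
    show "(f(s := v)) i \<in> X i" if "i < Suc s" for i
      using that v(1) fv(2) by (cases "i = s") auto
    show "({(f(s := v)) i, (f(s := v)) j} \<in> E) = F i j" if ij: "i < Suc s" "j < Suc s" "i \<noteq> j" for i j
    proof -
      consider "i < s" "j < s" | "i = s" "j < s" | "i < s" "j = s" using ij by linarith
      then show ?thesis
      proof cases
        case 1
        then show ?thesis using f(2) ij(3) by simp
      next
        case 2
        then show ?thesis using fv(1)[of j] sym[of j s] by simp
      next
        case 3
        then show ?thesis using fv(1)[of i] by (simp add: insert_commute)
      qed
    qed
  qed
qed

lemma ex_disjoint_subsets:
  assumes "finite R" "s * M \<le> card R"
  shows "\<exists>X :: nat \<Rightarrow> 'a set. (\<forall>i<s. X i \<subseteq> R \<and> card (X i) = M) \<and> (\<forall>i<s. \<forall>j<s. i \<noteq> j \<longrightarrow> X i \<inter> X j = {})"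
  using assms
proof (induction s arbitrary: R)
  case 0
  then show ?case by simp
next
  case (Suc s)
  obtain A where A: "A \<subseteq> R" "card A = M" using obtain_subset_with_card_n[of M R] Suc.prems(2) by auto
  have "s * M \<le> card (R - A)"
    using Suc.prems A card_Diff_subset[of A R] finite_subset[OF A(1)] by simp
  then obtain X :: "nat \<Rightarrow> 'a set" where X: "\<forall>i<s. X i \<subseteq> R - A \<and> card (X i) = M"
      "\<forall>i<s. \<forall>j<s. i \<noteq> j \<longrightarrow> X i \<inter> X j = {}"
    using Suc.IH[of "R - A"] Suc.prems(1) by blast
  show ?case
  proof (intro exI[of _ "X(s := A)"] conjI allI impI)
    show "(X(s := A)) i \<subseteq> R" "card ((X(s := A)) i) = M" if "i < Suc s" for i
      using that A X(1) by (auto simp: less_Suc_eq)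
    show "(X(s := A)) i \<inter> (X(s := A)) j = {}" if ij: "i < Suc s" "j < Suc s" "i \<noteq> j" for i j
    proof -
      consider "i < s" "j < s" | "i = s" "j < s" | "i < s" "j = s" using ij by linarith
      then show ?thesis
      proof cases
        case 1
        then show ?thesis using X(2) ij(3) by simp
      next
        case 2
        then have "X j \<subseteq> R - A" using X(1) by blast
        then show ?thesis using 2 by auto
      next
        case 3
        then have "X i \<subseteq> R - A" using X(1) by blast
        then show ?thesis using 3 by auto
      qed
    qed
  qed
qed

text \<open>As every pattern embeds, the smaller gadget is taken, a matching on 12 vertices. Of the
  vertices, \<open>24 * d\<close> allow for \<open>2 * d\<close> absorbers, and
  \<open>12 * M\<close> provide disjoint candidate sets for the next one.\<close>

lemma even_dec_middle:
  fixes \<epsilon> :: real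
  assumes fin: "finite V" and ev: "even_edges V" and eps: "0 < \<epsilon>" "\<epsilon> \<le> 1" and d: "d \<ge> 1"
    and dense: "\<And>A B Q. A \<subseteq> V \<Longrightarrow> B \<subseteq> V \<Longrightarrow> A \<inter> B = {} \<Longrightarrow> d \<le> card A \<Longrightarrow> d \<le> card B \<Longrightarrow>
      \<epsilon> * card A * card B \<le> card {(a, b) \<in> A \<times> B. ({a, b} \<in> E) = Q}"
    and M: "12 * real d \<le> \<epsilon> ^ 12 * M" and card: "24 * d + 12 * M \<le> card V"
  shows "even_dec E V"
proof (rule even_dec_criterion[OF fin ev, of "2 * d" 2 12])
  show "card K < 2 * d + 2" if K: "K \<subseteq> V" "clique K" for K
  proof -
    have "card K < 2 * d"
    proof (rule clique_card_less[OF _ K])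
      fix A B assume AB: "A \<subseteq> V" "B \<subseteq> V" "A \<inter> B = {}" "d \<le> card A" "d \<le> card B"
      have "0 < \<epsilon> * card A * card B" using eps d AB by simp
      also have "\<dots> \<le> card {(a, b) \<in> A \<times> B. ({a, b} \<in> E) = False}" by (rule dense[OF AB])
      finally have "{(a, b) \<in> A \<times> B. ({a, b} \<in> E) = False} \<noteq> {}"
        by (metis card.empty of_nat_0 less_irrefl)
      then show "\<exists>a\<in>A. \<exists>b\<in>B. {a, b} \<notin> E" by auto
    qed
    then show ?thesis by simp
  qed
  fix R assume R: "R \<subseteq> V" "card V \<le> card R + 12 * (2 * d)"
  have finR: "finite R" using R(1) fin finite_subset by blast
  have "12 * M \<le> card R" using R(2) card by simp
  then obtain X :: "nat \<Rightarrow> 'a set" where X: "\<forall>i<12. X i \<subseteq> R \<and> card (X i) = M"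
      "\<forall>i<12. \<forall>j<12. i \<noteq> j \<longrightarrow> X i \<inter> X j = {}"
    using ex_disjoint_subsets[OF finR, of 12 M] by blast
  have "\<exists>f. (\<forall>i<12. f i \<in> X i) \<and> (\<forall>i<12. \<forall>j<12. i \<noteq> j \<longrightarrow> ({f i, f j} \<in> E) = matching_pattern i j)"
  proof (rule embed_graph[OF fin eps, where d = "real d" and m = 12])
    show "\<epsilon> * card A * card B \<le> card {(a, b) \<in> A \<times> B. ({a, b} \<in> E) = Q}"
      if "A \<subseteq> V" "B \<subseteq> V" "A \<inter> B = {}" "real d \<le> card A" "real d \<le> card B" for A B Q
      using that by (intro dense) auto
    show "X i \<subseteq> V" if "i < 12" for i using X(1) that R(1) by blast
  qed (use d X M in \<open>auto simp: matching_pattern_def\<close>)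
  then obtain f where f: "\<forall>i<12. f i \<in> X i"
    "\<forall>i<12. \<forall>j<12. i \<noteq> j \<longrightarrow> ({f i, f j} \<in> E) = matching_pattern i j" by blast
  have "inj_on f {..<12}"
  proof (rule inj_onI, rule ccontr)
    fix i j :: nat assume "i \<in> {..<12}" "j \<in> {..<12}" "f i = f j" "i \<noteq> j"
    then have "f i \<in> X i" "f i \<in> X j" "X i \<inter> X j = {}" using f(1) X(2) by auto
    then show False by blast
  qed
  then have "copy matching_pattern 12 f" using f(2) unfolding copy_def by blast
  moreover have "f ` {..<12} \<subseteq> R" using f(1) X(1) by blast
  moreover have "card (f ` {..<12}) \<le> 12" using card_image_le[of "{..<12}" f] by simp
  ultimately show "\<exists>T\<subseteq>R. absorber 2 T \<and> card T \<le> 12" using absorber_matching by blast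
qed (use d in simp)

end

section \<open>Probability bounds\<close>

lemma finite_all_pairs [simp]: "finite (all_pairs n)"
  unfolding all_pairs_def by (rule finite_subset[of _ "Pow {0..<n}"]) auto

definition weight :: "nat \<Rightarrow> real \<Rightarrow> nat set set \<Rightarrow> real" where
  "weight n p E = p ^ card E * (1 - p) ^ (card (all_pairs n) - card E)"

lemma gnp_prob_weight: "gnp_prob n p P = (\<Sum>E | E \<subseteq> all_pairs n \<and> P E. weight n p E)"
  unfolding gnp_prob_def weight_def Pow_def
  by (subst sum.inter_filter[symmetric]) auto

lemma weight_nonneg: "0 \<le> p \<Longrightarrow> p \<le> 1 \<Longrightarrow> 0 \<le> weight n p E"
  by (simp add: weight_def)

lemma gnp_prob_mono:
  assumes "0 \<le> p" "p \<le> 1" "\<And>E. E \<subseteq> all_pairs n \<Longrightarrow> P E \<Longrightarrow> Q E"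
  shows "gnp_prob n p P \<le> gnp_prob n p Q"
  unfolding gnp_prob_weight
  by (rule sum_mono2) (use assms weight_nonneg in auto)

lemma gnp_prob_disj:
  assumes "0 \<le> p" "p \<le> 1"
  shows "gnp_prob n p (\<lambda>E. P E \<or> Q E) \<le> gnp_prob n p P + gnp_prob n p Q"
  unfolding gnp_prob_def sum.distrib[symmetric]
  by (rule sum_mono) (use assms in auto)

lemma gnp_prob_union:
  assumes "0 \<le> p" "p \<le> 1" "finite I"
  shows "gnp_prob n p (\<lambda>E. \<exists>i\<in>I. P i E) \<le> (\<Sum>i\<in>I. gnp_prob n p (P i))"
  using assms(3)
proof (induction I rule: finite_induct)
  case empty
  then show ?case by (simp add: gnp_prob_def)
next
  case (insert i I)
  have "gnp_prob n p (\<lambda>E. \<exists>i\<in>insert i I. P i E) = gnp_prob n p (\<lambda>E. P i E \<or> (\<exists>i\<in>I. P i E))"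
    by simp
  also have "\<dots> \<le> gnp_prob n p (P i) + gnp_prob n p (\<lambda>E. \<exists>i\<in>I. P i E)"
    by (rule gnp_prob_disj[OF assms(1,2)])
  finally show ?case using insert by simp
qed

text \<open>A product over all pairs of (edge term + non-edge term) expands into the sum over all
  graphs. This identity is the only form in which independence enters; each tail bound below is a
  choice of \<open>x\<close> and \<open>y\<close>.\<close>

lemma gnp_moment:
  assumes "F \<subseteq> all_pairs n"
  shows "(\<Sum>E\<in>Pow (all_pairs n). weight n p E * (x ^ card (E \<inter> F) * y ^ card (F - E))) =
    (p * x + (1 - p) * y) ^ card F"
proof -
  let ?U = "all_pairs n"
  define a where "a e = (if e \<in> F then p * x else p)" for e
  define b where "b e = (if e \<in> F then (1 - p) * y else 1 - p)" for e
  have fin: "finite F" using finite_subset[OF assms] by simp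
  have "weight n p E * (x ^ card (E \<inter> F) * y ^ card (F - E)) = prod a E * prod b (?U - E)"
    if E: "E \<subseteq> ?U" for E
  proof -
    have finE: "finite E" using finite_subset[OF E] by simp
    have "prod a E = (\<Prod>e\<in>E. p * (if e \<in> F then x else 1))" unfolding a_def by (rule prod.cong) simp_all
    also have "\<dots> = p ^ card E * (\<Prod>e\<in>E. if e \<in> F then x else 1)"
      by (simp add: prod.distrib)
    also have "(\<Prod>e\<in>E. if e \<in> F then x else 1) = x ^ card (E \<inter> F)"
      using finE by (simp add: prod.If_cases)
    finally have A: "prod a E = p ^ card E * x ^ card (E \<inter> F)" .
    have "prod b (?U - E) = (\<Prod>e\<in>?U - E. (1 - p) * (if e \<in> F then y else 1))"
      unfolding b_def by (rule prod.cong) simp_all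
    also have "\<dots> = (1 - p) ^ card (?U - E) * (\<Prod>e\<in>?U - E. if e \<in> F then y else 1)"
      by (simp add: prod.distrib)
    also have "(\<Prod>e\<in>?U - E. if e \<in> F then y else 1) = y ^ card ((?U - E) \<inter> F)"
      by (simp add: prod.If_cases)
    also have "(?U - E) \<inter> F = F - E" using assms by auto
    also have "card (?U - E) = card ?U - card E" using E finE by (simp add: card_Diff_subset)
    finally have "prod b (?U - E) = (1 - p) ^ (card ?U - card E) * y ^ card (F - E)" .
    then show ?thesis using A by (simp add: weight_def)
  qed
  then have "(\<Sum>E\<in>Pow ?U. weight n p E * (x ^ card (E \<inter> F) * y ^ card (F - E))) =
      (\<Sum>E\<in>Pow ?U. prod a E * prod b (?U - E))" by (intro sum.cong) auto
  also have "\<dots> = (\<Prod>e\<in>?U. a e + b e)" by (simp add: prod_add)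
  \<comment> \<open>A pair outside \<open>F\<close> contributes
    \<open>p + (1 - p) = 1\<close>.\<close>
  also have "\<dots> = (\<Prod>e\<in>?U. if e \<in> F then p * x + (1 - p) * y else 1)"
    unfolding a_def b_def by (rule prod.cong) simp_all
  also have "\<dots> = (p * x + (1 - p) * y) ^ card F"
    using assms by (simp add: prod.If_cases Int_absorb1)
  finally show ?thesis .
qed

text \<open>The indicator of the event is dominated pointwise by \<open>c\<close> times the weighted
  count, so \<open>c\<close> plays the role of an inverse threshold.\<close>

lemma gnp_prob_markov:
  assumes p: "0 \<le> p" "p \<le> 1" and F: "F \<subseteq> all_pairs n" and xy: "0 \<le> x" "0 \<le> y"
    and P: "\<And>E. E \<subseteq> all_pairs n \<Longrightarrow> P E \<Longrightarrow> 1 \<le> c * (x ^ card (E \<inter> F) * y ^ card (F - E))" and c: "0 \<le> c"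
  shows "gnp_prob n p P \<le> c * (p * x + (1 - p) * y) ^ card F"
proof -
  have "gnp_prob n p P \<le>
      (\<Sum>E\<in>Pow (all_pairs n). c * (weight n p E * (x ^ card (E \<inter> F) * y ^ card (F - E))))"
    unfolding gnp_prob_def
  proof (rule sum_mono)
    fix E assume E: "E \<in> Pow (all_pairs n)"
    let ?t = "x ^ card (E \<inter> F) * y ^ card (F - E)"
    have w: "0 \<le> weight n p E" using p by (rule weight_nonneg)
    have "P E \<Longrightarrow> weight n p E * 1 \<le> weight n p E * (c * ?t)"
      using P[of E] E w by (intro mult_left_mono) auto
    moreover have "0 \<le> c * (weight n p E * ?t)" using c w xy by simp
    ultimately show "(if P E then p ^ card E * (1 - p) ^ (card (all_pairs n) - card E) else 0)
        \<le> c * (weight n p E * ?t)"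
      by (simp add: weight_def[symmetric] mult_ac)
  qed
  also have "\<dots> = c * (p * x + (1 - p) * y) ^ card F"
    using gnp_moment[OF F] by (simp add: sum_distrib_left[symmetric])
  finally show ?thesis .
qed

lemma gnp_prob_le_1:
  assumes "0 \<le> p" "p \<le> 1"
  shows "gnp_prob n p P \<le> 1"
  using gnp_prob_markov[of p "{}" n 1 1 P 1] assms by simp

text \<open>Since \<open>0 ^ 0 = 1\<close>, the choice \<open>x = 1\<close>, \<open>y = 0\<close>
  turns the moment into the indicator of \<open>F \<subseteq> E\<close>.\<close>

lemma gnp_prob_subset:
  assumes "0 \<le> p" "p \<le> 1" "F \<subseteq> all_pairs n"
  shows "gnp_prob n p (\<lambda>E. F \<subseteq> E) \<le> p ^ card F"
  using gnp_prob_markov[OF assms, of 1 0 "\<lambda>E. F \<subseteq> E" 1] by (auto simp: Diff_eq_empty_iff[THEN iffD2])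

section \<open>Tail bounds for small cliques, degrees and pairs of large sets\<close>

definition cross :: "'a set \<Rightarrow> 'a set \<Rightarrow> 'a set set" where
  "cross A B = (\<lambda>(a, b). {a, b}) ` (A \<times> B)"

lemma inj_cross: "A \<inter> B = {} \<Longrightarrow> inj_on (\<lambda>(a, b). {a, b}) (A \<times> B)"
  by (auto simp: inj_on_def doubleton_eq_iff)

lemma card_cross: "A \<inter> B = {} \<Longrightarrow> card (cross A B) = card A * card B"
  unfolding cross_def by (simp add: card_image inj_cross card_cartesian_product)

lemma cross_subset: "A \<subseteq> {0..<n} \<Longrightarrow> B \<subseteq> {0..<n} \<Longrightarrow> A \<inter> B = {} \<Longrightarrow> cross A B \<subseteq> all_pairs n"
  by (auto simp: cross_def all_pairs_def card_insert_if)

lemma card_cross_Int: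
  assumes "A \<inter> B = {}"
  shows "card (E \<inter> cross A B) = card {(a, b) \<in> A \<times> B. {a, b} \<in> E}"
    "card (cross A B - E) = card {(a, b) \<in> A \<times> B. {a, b} \<notin> E}"
proof -
  have "E \<inter> cross A B = (\<lambda>(a, b). {a, b}) ` {(a, b) \<in> A \<times> B. {a, b} \<in> E}"
    unfolding cross_def by auto
  then show "card (E \<inter> cross A B) = card {(a, b) \<in> A \<times> B. {a, b} \<in> E}"
    by (simp only:) (intro card_image inj_on_subset[OF inj_cross[OF assms]], auto)
  have "cross A B - E = (\<lambda>(a, b). {a, b}) ` {(a, b) \<in> A \<times> B. {a, b} \<notin> E}"
    unfolding cross_def by auto
  then show "card (cross A B - E) = card {(a, b) \<in> A \<times> B. {a, b} \<notin> E}"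
    by (simp only:) (intro card_image inj_on_subset[OF inj_cross[OF assms]], auto)
qed

lemma simple_graph_all_pairs: "E \<subseteq> all_pairs n \<Longrightarrow> simple_graph E"
  by unfold_locales (auto simp: all_pairs_def)

text \<open>Each four-set has six pairs, and there are at most n^4 four-sets. For \<open>p\<close>
  of order 1/n this gives the order n^-2 of the final bound; the estimates for the other ranges
  decay exponentially.\<close>

lemma gnp_K4:
  assumes p: "0 \<le> p" "p \<le> 1"
  shows "gnp_prob n p (\<lambda>E. even_non_dec E {0..<n}) \<le> real n ^ 4 * p ^ 6"
proof -
  define I where "I = {K. K \<subseteq> {0..<n} \<and> card K = 4}"
  have fin: "finite I" unfolding I_def by simp
  have "gnp_prob n p (\<lambda>E. even_non_dec E {0..<n}) \<le>
      gnp_prob n p (\<lambda>E. \<exists>K\<in>I. {e. e \<subseteq> K \<and> card e = 2} \<subseteq> E)"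
  proof (rule gnp_prob_mono[OF p])
    fix E assume E: "E \<subseteq> all_pairs n" "even_non_dec E {0..<n}"
    interpret simple_graph E using E(1) by (rule simple_graph_all_pairs)
    obtain K where K: "K \<subseteq> {0..<n}" "card K = 4" "clique K"
      using even_dec_or_K4[of "{0..<n}"] E(2) by (auto simp: even_non_dec_def even_edges_def)
    have "e \<in> E" if "e \<subseteq> K" "card e = 2" for e
    proof -
      obtain u v where "e = {u, v}" "u \<noteq> v" using \<open>card e = 2\<close> by (auto simp: card_2_iff)
      then show ?thesis using K(3) \<open>e \<subseteq> K\<close> unfolding clique_def by simp
    qed
    then show "\<exists>K\<in>I. {e. e \<subseteq> K \<and> card e = 2} \<subseteq> E" using K(1,2) unfolding I_def by blast
  qed
  also have "\<dots> \<le> (\<Sum>K\<in>I. gnp_prob n p (\<lambda>E. {e. e \<subseteq> K \<and> card e = 2} \<subseteq> E))"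
    by (rule gnp_prob_union[OF p fin])
  also have "\<dots> \<le> (\<Sum>K\<in>I. p ^ 6)"
  proof (rule sum_mono)
    fix K assume K: "K \<in> I"
    then have c: "card {e. e \<subseteq> K \<and> card e = 2} = 6"
      using n_subsets[of K 2] finite_subset[of K "{0..<n}"] by (simp add: I_def choose_two)
    have s: "{e. e \<subseteq> K \<and> card e = 2} \<subseteq> all_pairs n" using K by (auto simp: I_def all_pairs_def)
    show "gnp_prob n p (\<lambda>E. {e. e \<subseteq> K \<and> card e = 2} \<subseteq> E) \<le> p ^ 6"
      using gnp_prob_subset[OF p s] unfolding c .
  qed
  also have "\<dots> = real (n choose 4) * p ^ 6" using n_subsets[of "{0..<n}" 4] by (simp add: I_def)
  also have "\<dots> \<le> real n ^ 4 * p ^ 6"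
  proof (rule mult_right_mono)
    show "real (n choose 4) \<le> real n ^ 4"
      using binomial_le_pow[of 4 n] by (cases "4 \<le> n") (auto simp: binomial_eq_0 simp flip: of_nat_power)
  qed (use p in simp)
  finally show ?thesis .
qed

text \<open>\<open>Q\<close> selects edges or non-edges, so a sparse graph and the complement of a
  dense one share all estimates.\<close>

abbreviation pair_prob :: "real \<Rightarrow> bool \<Rightarrow> real" where
  "pair_prob p Q \<equiv> if Q then p else 1 - p"

definition large_pairs :: "nat \<Rightarrow> nat \<Rightarrow> (nat set \<times> nat set) set" where
  "large_pairs n d = {(A, B). A \<subseteq> {0..<n} \<and> B \<subseteq> {0..<n} \<and> A \<inter> B = {} \<and> d \<le> card A \<and> d \<le> card B}"

lemma finite_large_pairs: "finite (large_pairs n d)"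
  and card_large_pairs: "card (large_pairs n d) \<le> 4 ^ n"
proof -
  have sub: "large_pairs n d \<subseteq> Pow {0..<n} \<times> Pow {0..<n}" unfolding large_pairs_def by auto
  then show "finite (large_pairs n d)" by (rule finite_subset) simp
  have "card (large_pairs n d) \<le> card (Pow {0..<n} \<times> Pow {0..<n})" by (rule card_mono[OF _ sub]) simp
  also have "\<dots> = 4 ^ n" by (simp add: card_cartesian_product card_Pow power_mult_distrib[symmetric])
  finally show "card (large_pairs n d) \<le> 4 ^ n" .
qed

lemma gnp_prob_large_pairs:
  assumes p: "0 \<le> p" "p \<le> 1"
    and "\<And>A B. (A, B) \<in> large_pairs n d \<Longrightarrow> gnp_prob n p (P A B) \<le> c"
    and c: "0 \<le> c"
  shows "gnp_prob n p (\<lambda>E. \<exists>(A, B)\<in>large_pairs n d. P A B E) \<le> 4 ^ n * c"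
proof -
  have "gnp_prob n p (\<lambda>E. \<exists>i\<in>large_pairs n d. P (fst i) (snd i) E) \<le>
      (\<Sum>i\<in>large_pairs n d. gnp_prob n p (P (fst i) (snd i)))"
    by (rule gnp_prob_union[OF p finite_large_pairs])
  also have "\<dots> \<le> (\<Sum>i\<in>large_pairs n d. c)" by (intro sum_mono assms(3)) simp
  also have "\<dots> = real (card (large_pairs n d)) * c" by simp
  also have "\<dots> \<le> 4 ^ n * c"
    using card_large_pairs[of n d] c by (intro mult_right_mono) (simp_all flip: of_nat_le_iff)
  finally show ?thesis by (simp add: case_prod_beta)
qed

lemma gnp_prob_homogeneous_pair:
  assumes p: "0 \<le> p" "p \<le> 1"
  shows "gnp_prob n p (\<lambda>E. \<exists>(A, B)\<in>large_pairs n d. \<forall>a\<in>A. \<forall>b\<in>B. ({a, b} \<in> E) \<noteq> Q)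
    \<le> 4 ^ n * (1 - pair_prob p Q) ^ (d * d)"
proof (rule gnp_prob_large_pairs[OF p])
  fix A B assume AB: "(A, B) \<in> large_pairs n d"
  then have sub: "A \<subseteq> {0..<n}" "B \<subseteq> {0..<n}" "A \<inter> B = {}" and d: "d \<le> card A" "d \<le> card B"
    unfolding large_pairs_def by auto
  \<comment> \<open>The base 0 makes the moment an indicator of a homogeneous pair, again because
    \<open>0 ^ 0 = 1\<close>.\<close>
  let ?x = "if Q then 0 else (1::real)" and ?y = "if Q then 1 else (0::real)"
  have "gnp_prob n p (\<lambda>E. \<forall>a\<in>A. \<forall>b\<in>B. ({a, b} \<in> E) \<noteq> Q)
      \<le> 1 * (p * ?x + (1 - p) * ?y) ^ card (cross A B)"
  proof (rule gnp_prob_markov[OF p cross_subset[OF sub]])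
    fix E assume *: "\<forall>a\<in>A. \<forall>b\<in>B. ({a, b} \<in> E) \<noteq> Q"
    show "1 \<le> 1 * (?x ^ card (E \<inter> cross A B) * ?y ^ card (cross A B - E))"
    proof (cases Q)
      case True
      then have "E \<inter> cross A B = {}" using * by (auto simp: cross_def)
      then show ?thesis using True by simp
    next
      case False
      then have "cross A B - E = {}" using * by (auto simp: cross_def)
      then have "card (cross A B - E) = 0" by (simp only: card.empty)
      then show ?thesis using False by simp
    qed
  qed auto
  also have "\<dots> = (1 - pair_prob p Q) ^ (card A * card B)" using card_cross[OF sub(3)] by simp
  also have "\<dots> \<le> (1 - pair_prob p Q) ^ (d * d)"
    using p d by (intro power_decreasing mult_le_mono) auto
  finally show "gnp_prob n p (\<lambda>E. \<forall>a\<in>A. \<forall>b\<in>B. ({a, b} \<in> E) \<noteq> Q) \<le> (1 - pair_prob p Q) ^ (d * d)" .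
qed (use p in simp)

text \<open>Markov's inequality is applied to 2 raised to the degree; every other vertex contributes
  the mean \<open>1 + pair_prob p Q\<close>.\<close>

lemma gnp_prob_large_degree:
  assumes p: "0 \<le> p" "p \<le> 1"
  shows "gnp_prob n p (\<lambda>E. \<exists>v\<in>{0..<n}. D < card {u \<in> {0..<n}. u \<noteq> v \<and> ({u, v} \<in> E) = Q})
    \<le> n * ((1 + pair_prob p Q) ^ n / 2 ^ D)"
proof -
  have "gnp_prob n p (\<lambda>E. \<exists>v\<in>{0..<n}. D < card {u \<in> {0..<n}. u \<noteq> v \<and> ({u, v} \<in> E) = Q})
      \<le> (\<Sum>v\<in>{0..<n}. gnp_prob n p (\<lambda>E. D < card {u \<in> {0..<n}. u \<noteq> v \<and> ({u, v} \<in> E) = Q}))"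
    by (rule gnp_prob_union[OF p]) simp
  also have "\<dots> \<le> (\<Sum>v\<in>{0..<n}. (1 + pair_prob p Q) ^ n / 2 ^ D)"
  proof (rule sum_mono)
    fix v assume v: "v \<in> {0..<n}"
    let ?B = "{0..<n} - {v}"
    let ?x = "if Q then 2 else (1::real)" and ?y = "if Q then 1 else (2::real)"
    have sub: "{v} \<subseteq> {0..<n}" "?B \<subseteq> {0..<n}" "{v} \<inter> ?B = {}" using v by auto
    have "gnp_prob n p (\<lambda>E. D < card {u \<in> {0..<n}. u \<noteq> v \<and> ({u, v} \<in> E) = Q})
        \<le> (1 / 2 ^ D) * (p * ?x + (1 - p) * ?y) ^ card (cross {v} ?B)"
    proof (rule gnp_prob_markov[OF p cross_subset[OF sub]])
      fix E assume *: "D < card {u \<in> {0..<n}. u \<noteq> v \<and> ({u, v} \<in> E) = Q}" (is "D < card ?N")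
      have "{(a, b) \<in> {v} \<times> ?B. ({a, b} \<in> E) = Q} = {v} \<times> ?N" by (auto simp: insert_commute)
      then have N: "card {(a, b) \<in> {v} \<times> ?B. ({a, b} \<in> E) = Q} = card ?N"
        by (simp add: card_cartesian_product)
      have "(2::real) ^ D \<le> 2 ^ card ?N" using * by (intro power_increasing) auto
      also have "\<dots> = ?x ^ card (E \<inter> cross {v} ?B) * ?y ^ card (cross {v} ?B - E)"
        using card_cross_Int[OF sub(3), of E] N by (cases Q) simp_all
      finally show "1 \<le> (1 / 2 ^ D) * (?x ^ card (E \<inter> cross {v} ?B) * ?y ^ card (cross {v} ?B - E))"
        by (simp add: field_simps)
    qed auto
    also have "\<dots> = (1 / 2 ^ D) * (1 + pair_prob p Q) ^ card (cross {v} ?B)"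
    proof -
      have "p * ?x + (1 - p) * ?y = 1 + pair_prob p Q" by simp
      then show ?thesis by (simp only:)
    qed
    also have "\<dots> \<le> (1 / 2 ^ D) * (1 + pair_prob p Q) ^ n"
      using card_cross[OF sub(3)] v p
      by (intro mult_left_mono power_increasing) (auto simp: card_Diff_subset)
    finally show "gnp_prob n p (\<lambda>E. D < card {u \<in> {0..<n}. u \<noteq> v \<and> ({u, v} \<in> E) = Q})
        \<le> (1 + pair_prob p Q) ^ n / 2 ^ D" by (simp add: divide_right_mono)
  qed
  also have "\<dots> = n * ((1 + pair_prob p Q) ^ n / 2 ^ D)" by simp
  finally show ?thesis .
qed

text \<open>Markov's inequality is applied to 1/2 raised to the number of pairs of kind
  \<open>Q\<close>. As \<open>1 / 2\<close> is at least \<open>exp (- 1)\<close>, the threshold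
  costs a factor \<open>exp (\<rho> / 4)\<close> per pair, while the mean gains
  \<open>exp (- (\<rho> / 2))\<close> per pair.\<close>

lemma gnp_prob_low_density:
  assumes p: "0 \<le> p" "p \<le> 1" and \<rho>: "0 \<le> \<rho>" "\<rho> \<le> pair_prob p Q"
  shows "gnp_prob n p (\<lambda>E. \<exists>(A, B)\<in>large_pairs n d.
      card {(a, b) \<in> A \<times> B. ({a, b} \<in> E) = Q} < \<rho> / 4 * card A * card B)
    \<le> 4 ^ n * exp (- (\<rho> / 4 * real (d * d)))"
proof (rule gnp_prob_large_pairs[OF p])
  fix A B assume AB: "(A, B) \<in> large_pairs n d"
  then have sub: "A \<subseteq> {0..<n}" "B \<subseteq> {0..<n}" "A \<inter> B = {}" and d: "d \<le> card A" "d \<le> card B"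
    unfolding large_pairs_def by auto
  let ?L = "card A * card B"
  let ?x = "if Q then 1/2 else (1::real)" and ?y = "if Q then 1 else (1/2::real)"
  let ?P = "\<lambda>E. card {(a, b) \<in> A \<times> B. ({a, b} \<in> E) = Q} < \<rho> / 4 * card A * card B"
  have "gnp_prob n p ?P \<le> exp (\<rho> / 4 * ?L) * (p * ?x + (1 - p) * ?y) ^ card (cross A B)"
  proof (rule gnp_prob_markov[OF p cross_subset[OF sub]])
    fix E assume "?P E"
    let ?N = "card {(a, b) \<in> A \<times> B. ({a, b} \<in> E) = Q}"
    have N: "?N \<le> \<rho> / 4 * ?L" using \<open>?P E\<close> by (simp add: mult_ac)
    have "1 \<le> exp (\<rho> / 4 * ?L) * exp (- real ?N)" using N by (simp flip: exp_add)
    also have "\<dots> \<le> exp (\<rho> / 4 * ?L) * (1 / 2) ^ ?N"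
    proof (rule mult_left_mono)
      have "exp (- real ?N) = exp (- 1) ^ ?N" by (simp flip: exp_of_nat_mult)
      also have "\<dots> \<le> (1 / 2) ^ ?N"
        using exp_ge_add_one_self[of 1] by (intro power_mono) (simp_all add: exp_minus field_simps)
      finally show "exp (- real ?N) \<le> (1 / 2) ^ ?N" .
    qed simp
    also have "(1 / 2) ^ ?N = ?x ^ card (E \<inter> cross A B) * ?y ^ card (cross A B - E)"
      using card_cross_Int[OF sub(3), of E] by (cases Q) simp_all
    finally show "1 \<le> exp (\<rho> / 4 * ?L) * (?x ^ card (E \<inter> cross A B) * ?y ^ card (cross A B - E))" .
  qed auto
  also have "\<dots> = exp (\<rho> / 4 * ?L) * (1 - pair_prob p Q / 2) ^ card (cross A B)"
  proof -
    have "p * ?x + (1 - p) * ?y = 1 - pair_prob p Q / 2" by (simp add: field_simps)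
    then show ?thesis by (simp only:)
  qed
  also have "\<dots> \<le> exp (\<rho> / 4 * ?L) * exp (- (\<rho> / 2)) ^ ?L"
  proof (intro mult_left_mono)
    have "1 - pair_prob p Q / 2 \<le> exp (- (pair_prob p Q / 2))"
      using exp_ge_add_one_self[of "- (pair_prob p Q / 2)"] by simp
    also have "\<dots> \<le> exp (- (\<rho> / 2))" using \<rho>(2) by simp
    finally show "(1 - pair_prob p Q / 2) ^ card (cross A B) \<le> exp (- (\<rho> / 2)) ^ ?L"
      unfolding card_cross[OF sub(3)] using p by (intro power_mono) auto
  qed simp
  also have "\<dots> = exp (- (\<rho> / 4 * ?L))"
    by (simp flip: exp_of_nat_mult exp_add add: field_simps)
  also have "\<dots> \<le> exp (- (\<rho> / 4 * (d * d)))"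
  proof -
    have "real (d * d) \<le> real ?L" using d by (intro of_nat_mono mult_le_mono)
    then have "\<rho> / 4 * (d * d) \<le> \<rho> / 4 * ?L" using \<rho>(1) by (intro mult_left_mono) simp_all
    then show ?thesis by simp
  qed
  finally show "gnp_prob n p ?P \<le> exp (- (\<rho> / 4 * real (d * d)))" .
qed simp

text \<open>The inequality \<open>t \<le> exp t\<close> is applied to
  \<open>t = \<alpha> * x / k\<close> and raised to the power \<open>k\<close>.\<close>

lemma power_mult_exp_le:
  fixes \<alpha> x :: real
  assumes "0 < \<alpha>" "0 \<le> x" "k > 0"
  shows "x ^ k * exp (- (\<alpha> * x)) \<le> (k / \<alpha>) ^ k"
proof -
  have "\<alpha> * x / k \<le> exp (\<alpha> * x / k)" using exp_ge_add_one_self[of "\<alpha> * x / k"] by linarith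
  then have "(\<alpha> * x / k) ^ k \<le> exp (\<alpha> * x / k) ^ k" using assms by (intro power_mono) auto
  also have "\<dots> = exp (\<alpha> * x)" using assms(3) by (simp flip: exp_of_nat_mult)
  finally have "x ^ k * \<alpha> ^ k \<le> exp (\<alpha> * x) * k ^ k" using assms
    by (simp add: power_divide power_mult_distrib field_simps)
  then show ?thesis using assms by (simp add: exp_minus field_simps)
qed

section \<open>Assembling the bounds for each density range\<close>

lemma gnp_prob_sparse_or_dense:
  assumes n: "n \<ge> 10 ^ 5" and p: "0 \<le> p" "p \<le> 1"
    and \<rho>: "10 ^ 5 / n \<le> pair_prob p Q" "pair_prob p Q \<le> 1 / 2000"
  shows "gnp_prob n p (\<lambda>E. even_non_dec E {0..<n}) \<le> exp (- (n / 10)) + 2 * n * exp (- (3 / 4000 * n))"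
proof -
  \<comment> \<open>With these values \<open>134 * d + 68 * (D + 1)\<close> is about 0.706 n, which
    leaves room in the dense criterion; the sparse one needs far less.\<close>
  define d where "d = n div 250 + 1"
  define D where "D = n div 400"
  let ?\<rho> = "pair_prob p Q"
  let ?A = "\<lambda>E. \<exists>(A, B)\<in>large_pairs n d. \<forall>a\<in>A. \<forall>b\<in>B. ({a, b} \<in> E) \<noteq> Q"
  let ?B = "\<lambda>E. \<exists>v\<in>{0..<n}. D < card {u \<in> {0..<n}. u \<noteq> v \<and> ({u, v} \<in> E) = Q}"
  have rn: "real n \<ge> 10 ^ 5" using n by simp
  have d: "real n / 250 \<le> real d" "real d \<le> real n / 250 + 1"
    and D: "real n / 400 - 1 \<le> real D" "real D \<le> real n / 400"
    unfolding d_def D_def by linarith+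
  have "gnp_prob n p (\<lambda>E. even_non_dec E {0..<n}) \<le> gnp_prob n p (\<lambda>E. ?A E \<or> ?B E)"
  proof (rule gnp_prob_mono[OF p])
    fix E assume E: "E \<subseteq> all_pairs n" "even_non_dec E {0..<n}"
    interpret simple_graph E using E(1) by (rule simple_graph_all_pairs)
    have ev: "even_edges {0..<n}" "\<not> even_dec E {0..<n}"
      using E(2) by (auto simp: even_non_dec_def even_edges_def)
    show "?A E \<or> ?B E"
    proof (rule ccontr)
      assume neg: "\<not> (?A E \<or> ?B E)"
      have edge: "\<exists>a\<in>A. \<exists>b\<in>B. ({a, b} \<in> E) = Q"
        if "A \<subseteq> {0..<n}" "B \<subseteq> {0..<n}" "A \<inter> B = {}" "d \<le> card A" "d \<le> card B" for A B
      proof -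
        have "(A, B) \<in> large_pairs n d" using that by (simp add: large_pairs_def)
        then show ?thesis using neg by blast
      qed
      have deg: "card {u \<in> {0..<n}. u \<noteq> v \<and> ({u, v} \<in> E) = Q} \<le> D" if "v \<in> {0..<n}" for v
        using neg that by (meson not_le)
      have "even_dec E {0..<n}"
      proof (cases Q)
        case True
        have card: "real (2 * d + 24 * (D + 1)) \<le> real n" using d(2) D(2) rn by simp
        show ?thesis
        proof (rule even_dec_sparse[of _ D d])
          show "card (nb {0..<n} v) \<le> D" if v: "v \<in> {0..<n}" for v
          proof -
            have "nb {0..<n} v = {u \<in> {0..<n}. u \<noteq> v \<and> ({u, v} \<in> E) = Q}"
              using True edge_neq unfolding nb_def by auto
            then show ?thesis using deg[OF v] by simp
          qed
          show "\<exists>a\<in>A. \<exists>b\<in>B. {a, b} \<in> E"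
            if "A \<subseteq> {0..<n}" "B \<subseteq> {0..<n}" "A \<inter> B = {}" "d \<le> card A" "d \<le> card B" for A B
            using edge[OF that] True by simp
          show "2 * d + 24 * (D + 1) \<le> card {0..<n}"
            using card unfolding of_nat_le_iff by simp
        qed (use ev in simp_all)
      next
        case False
        have card: "real (134 * d + 68 * (D + 1)) \<le> real n" using d(2) D(2) rn by simp
        show ?thesis
        proof (rule even_dec_dense[of _ d D])
          show "card {u \<in> {0..<n}. u \<noteq> v \<and> {u, v} \<notin> E} \<le> D" if v: "v \<in> {0..<n}" for v
            using deg[OF v] False by simp
          show "\<exists>a\<in>A. \<exists>b\<in>B. {a, b} \<notin> E"
            if "A \<subseteq> {0..<n}" "B \<subseteq> {0..<n}" "A \<inter> B = {}" "d \<le> card A" "d \<le> card B" for A B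
            using edge[OF that] False by simp
          show "134 * d + 68 * (D + 1) \<le> card {0..<n}"
            using card unfolding of_nat_le_iff by simp
        qed (use ev in \<open>simp_all add: d_def\<close>)
      qed
      then show False using ev(2) by simp
    qed
  qed
  also have "\<dots> \<le> gnp_prob n p ?A + gnp_prob n p ?B" by (rule gnp_prob_disj[OF p])
  also have "gnp_prob n p ?A \<le> 4 ^ n * (1 - ?\<rho>) ^ (d * d)" by (rule gnp_prob_homogeneous_pair[OF p])
  also have "\<dots> \<le> exp (- (n / 10))"
  proof -
    have "(4::real) ^ n \<le> exp (3 / 2) ^ n"
    proof (rule power_mono)
      \<comment> \<open>The cube of 13/8 is about 4.29, which suffices for
        \<open>4 \<le> exp (3 / 2)\<close>.\<close>
      have "(13 / 8 :: real) \<le> exp (1 / 2)"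
        using exp_lower_Taylor_quadratic[of "1 / 2"] by (simp add: power2_eq_square)
      then have "(13 / 8 :: real) ^ 3 \<le> exp (1 / 2) ^ 3" by (intro power_mono) auto
      also have "\<dots> = exp (3 / 2 :: real)" by (simp flip: exp_of_nat_mult)
      finally show "(4::real) \<le> exp (3 / 2)" by (simp add: power3_eq_cube)
    qed simp
    also have "\<dots> = exp (3 / 2 * n)" by (simp flip: exp_of_nat_mult add: mult.commute)
    finally have four: "(4::real) ^ n \<le> exp (3 / 2 * n)" .
    have "1 - ?\<rho> \<le> exp (- ?\<rho>)" using exp_ge_add_one_self[of "- ?\<rho>"] by simp
    then have "(1 - ?\<rho>) ^ (d * d) \<le> exp (- ?\<rho>) ^ (d * d)" using p by (intro power_mono) auto
    also have "\<dots> = exp (- (?\<rho> * (d * d)))" by (simp flip: exp_of_nat_mult add: mult_ac)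
    also have "\<dots> \<le> exp (- (8 / 5 * n))"
    proof -
      have "(real n / 250) * (real n / 250) \<le> real d * real d" using d(1) by (intro mult_mono) auto
      with \<rho>(1) have "10 ^ 5 / n * ((real n / 250) * (real n / 250)) \<le> ?\<rho> * (real d * real d)"
        by (rule mult_mono) (use p in auto)
      moreover have "10 ^ 5 / n * ((real n / 250) * (real n / 250)) = 8 / 5 * n"
        using rn by (simp add: field_simps)
      ultimately have "8 / 5 * n \<le> ?\<rho> * (real d * real d)" by linarith
      then show ?thesis by (simp only: exp_le_cancel_iff neg_le_iff_le of_nat_mult)
    qed
    finally have "4 ^ n * (1 - ?\<rho>) ^ (d * d) \<le> exp (3 / 2 * n) * exp (- (8 / 5 * n))"
      using four p by (intro mult_mono) auto
    also have "\<dots> = exp (- (n / 10))" by (simp flip: exp_add)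
    finally show ?thesis .
  qed
  also have "gnp_prob n p ?B \<le> n * ((1 + ?\<rho>) ^ n / 2 ^ D)" by (rule gnp_prob_large_degree[OF p])
  also have "\<dots> \<le> n * (2 * exp (- (3 / 4000 * n)))"
  proof (rule mult_left_mono)
    have "1 + ?\<rho> \<le> exp (1 / 2000)" using exp_ge_add_one_self[of "1 / 2000 :: real"] \<rho>(2) by linarith
    then have "(1 + ?\<rho>) ^ n \<le> exp (1 / 2000) ^ n" using p by (intro power_mono) auto
    also have "\<dots> = exp (n / 2000)" by (simp flip: exp_of_nat_mult)
    finally have num: "(1 + ?\<rho>) ^ n \<le> exp (n / 2000)" .
    have half: "exp (1 / 2) \<le> (2::real)"
    proof -
      have "exp (1 / 2) = inverse (exp (- (1 / 2) :: real))" by (simp add: exp_minus)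
      also have "\<dots> \<le> inverse (1 / 2)"
        using exp_ge_add_one_self[of "- (1 / 2) :: real"] by (intro le_imp_inverse_le) auto
      finally show ?thesis by simp
    qed
    \<comment> \<open>Replacing 2 by the smaller \<open>exp (1 / 2)\<close> gives exponent
      \<open>D / 2\<close>, which is at least \<open>n / 800 - 1 / 2\<close>; the decay rate is then
      \<open>1 / 800 - 1 / 2000 = 3 / 4000\<close>.\<close>
    have "exp (n / 800 - 1 / 2) \<le> exp (D / 2)" using D(1) by simp
    also have "\<dots> = exp (1 / 2) ^ D" by (simp flip: exp_of_nat_mult)
    also have "\<dots> \<le> 2 ^ D" using half by (intro power_mono) auto
    finally have den: "exp (n / 800 - 1 / 2) \<le> 2 ^ D" .
    have "(1 + ?\<rho>) ^ n / 2 ^ D \<le> exp (n / 2000) / exp (n / 800 - 1 / 2)"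
      using num den p by (intro frac_le) auto
    also have "\<dots> = exp (1 / 2) * exp (- (3 / 4000 * n))" by (simp flip: exp_diff exp_add add: field_simps)
    also have "\<dots> \<le> 2 * exp (- (3 / 4000 * n))" using half by (intro mult_right_mono) auto
    finally show "(1 + ?\<rho>) ^ n / 2 ^ D \<le> 2 * exp (- (3 / 4000 * n))" .
  qed simp
  finally show ?thesis by simp
qed

lemma gnp_prob_middle:
  "\<exists>C. \<forall>n::nat. \<forall>p::real. n \<ge> 1 \<and> 1 / 2000 \<le> p \<and> p \<le> 1 - 1 / 2000 \<longrightarrow>
     gnp_prob n p (\<lambda>E. even_non_dec E {0..<n}) \<le> C / (real n)\<^sup>2"
proof -
  define \<rho> :: real where "\<rho> = 1 / 2000"
  \<comment> \<open>This is the density that \<open>gnp_prob_low_density\<close> guarantees. The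
    next constant \<open>\<eta>\<close> is the size of the sets relative to \<open>n\<close>, small
    enough for \<open>12 * d \<le> \<epsilon> ^ 12 * M\<close> with \<open>M\<close> about
    n/24.\<close>
  define \<epsilon> where "\<epsilon> = \<rho> / 4"
  define \<eta> where "\<eta> = \<epsilon> ^ 12 / 1000"
  \<comment> \<open>Once \<open>d\<close> is at least \<open>\<eta> * n / 2\<close>, the exponent
    \<open>\<rho> / 4 * d * d\<close> is at least \<open>\<kappa> * n * n\<close>.\<close>
  define \<kappa> where "\<kappa> = \<rho> * \<eta>\<^sup>2 / 16"
  \<comment> \<open>Beyond 100, rounding in \<open>M\<close> is harmless; beyond
    \<open>2 / \<eta>\<close>, rounding in \<open>d\<close> costs at most a half; beyond
    \<open>5 / \<kappa>\<close>, the exponent reaches \<open>5 * n\<close>, against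
    \<open>4 * n\<close> for the number of pairs.\<close>
  define N where "N = max (max 100 (2 / \<eta>)) (5 / \<kappa>)"
  have pos: "0 < \<rho>" "0 < \<epsilon>" "0 < \<eta>" "0 < \<kappa>" unfolding \<kappa>_def \<eta>_def \<epsilon>_def \<rho>_def by simp_all
  have eps1: "\<epsilon> \<le> 1" "\<epsilon> ^ 12 \<le> 1" unfolding \<epsilon>_def \<rho>_def by (simp_all add: power_le_one)
  have "gnp_prob n p (\<lambda>E. even_non_dec E {0..<n}) \<le> max (N\<^sup>2) 8 / (real n)\<^sup>2"
    if n1: "n \<ge> 1" and pp: "1 / 2000 \<le> p" "p \<le> 1 - 1 / 2000" for n :: nat and p :: real
  proof (cases "real n \<le> N")
    \<comment> \<open>For bounded \<open>n\<close> the trivial bound 1 is absorbed into the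
      constant.\<close>
    case True
    have "gnp_prob n p (\<lambda>E. even_non_dec E {0..<n}) \<le> 1" using pp by (intro gnp_prob_le_1) auto
    also have "1 \<le> N\<^sup>2 / (real n)\<^sup>2" using True n1 by (simp add: power_mono)
    also have "\<dots> \<le> max (N\<^sup>2) 8 / (real n)\<^sup>2" by (intro divide_right_mono) auto
    finally show ?thesis .
  next
    case False
    then have n: "100 \<le> real n" "2 / \<eta> \<le> real n" "5 / \<kappa> \<le> real n" unfolding N_def by auto
    have p: "0 \<le> p" "p \<le> 1" using pp by auto
    define d where "d = nat \<lfloor>\<eta> * n\<rfloor>"
    define M where "M = n div 24"
    have d: "real d \<le> \<eta> * n" "\<eta> * n - 1 \<le> real d"
    proof -
      have "real d = of_int \<lfloor>\<eta> * n\<rfloor>" using pos unfolding d_def by simp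
      then show "real d \<le> \<eta> * n" "\<eta> * n - 1 \<le> real d" by linarith+
    qed
    have \<eta>n: "2 \<le> \<eta> * n" using n(2) pos by (simp add: field_simps)
    have M: "real n / 24 - 1 \<le> real M" "real M \<le> real n / 24" unfolding M_def by linarith+
    let ?A = "\<lambda>Q E. \<exists>(A, B)\<in>large_pairs n d.
      card {(a, b) \<in> A \<times> B. ({a, b} \<in> E) = Q} < \<rho> / 4 * card A * card B"
    have "gnp_prob n p (\<lambda>E. even_non_dec E {0..<n}) \<le> gnp_prob n p (\<lambda>E. ?A True E \<or> ?A False E)"
    proof (rule gnp_prob_mono[OF p])
      fix E assume E: "E \<subseteq> all_pairs n" "even_non_dec E {0..<n}"
      interpret simple_graph E using E(1) by (rule simple_graph_all_pairs)
      have ev: "even_edges {0..<n}" "\<not> even_dec E {0..<n}"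
        using E(2) by (auto simp: even_non_dec_def even_edges_def)
      show "?A True E \<or> ?A False E"
      proof (rule ccontr)
        assume neg: "\<not> (?A True E \<or> ?A False E)"
        have "even_dec E {0..<n}"
        proof (rule even_dec_middle[where \<epsilon> = \<epsilon> and d = d and M = M])
          fix A B Q assume AB: "A \<subseteq> {0..<n}" "B \<subseteq> {0..<n}" "A \<inter> B = {}" "d \<le> card A" "d \<le> card B"
          then have "(A, B) \<in> large_pairs n d" by (simp add: large_pairs_def)
          moreover have "\<not> ?A Q E" using neg by (cases Q) simp_all
          ultimately show "\<epsilon> * card A * card B \<le> card {(a, b) \<in> A \<times> B. ({a, b} \<in> E) = Q}"
            unfolding \<epsilon>_def by (auto simp: not_less)
        next
          have "real d \<ge> 1" using d \<eta>n by linarith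
          then show "d \<ge> 1" by simp
          have "12 * (\<eta> * n) = \<epsilon> ^ 12 * (12 * n / 1000)" by (simp add: \<eta>_def)
          also have "\<dots> \<le> \<epsilon> ^ 12 * M" using M(1) n(1) pos by (intro mult_left_mono) auto
          finally show "12 * real d \<le> \<epsilon> ^ 12 * M" using d(1) by simp
          have "\<eta> * n \<le> n / 1000" using eps1 pos unfolding \<eta>_def by (simp add: mult_left_le_one_le)
          then have "real (24 * d + 12 * M) \<le> real n" using d(1) M(2) by simp
          then show "24 * d + 12 * M \<le> card {0..<n}" unfolding of_nat_le_iff by simp
        qed (use ev pos eps1 in auto)
        then show False using ev(2) by simp
      qed
    qed
    also have "\<dots> \<le> gnp_prob n p (?A True) + gnp_prob n p (?A False)" by (rule gnp_prob_disj[OF p])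
    also have "\<dots> \<le> 4 ^ n * exp (- (\<rho> / 4 * real (d * d))) + 4 ^ n * exp (- (\<rho> / 4 * real (d * d)))"
      by (intro add_mono gnp_prob_low_density p) (use pp pos in \<open>auto simp: \<rho>_def\<close>)
    also have "\<dots> = 2 * (4 ^ n * exp (- (\<rho> / 4 * real (d * d))))" by simp
    also have "\<dots> \<le> 2 * exp (- real n)"
    proof -
      have "(4::real) ^ n \<le> exp 4 ^ n" using exp_ge_add_one_self[of "4::real"] by (intro power_mono) auto
      also have "\<dots> = exp (4 * n)" by (simp flip: exp_of_nat_mult add: mult.commute)
      finally have four: "(4::real) ^ n \<le> exp (4 * n)" .
      have "\<eta> * n / 2 \<le> real d" using d(2) \<eta>n by linarith
      then have "(\<eta> * n / 2) * (\<eta> * n / 2) \<le> real d * real d" using pos by (intro mult_mono) auto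
      then have "\<rho> / 4 * ((\<eta> * n / 2) * (\<eta> * n / 2)) \<le> \<rho> / 4 * real (d * d)"
        unfolding of_nat_mult using pos by (intro mult_left_mono) auto
      moreover have "\<rho> / 4 * ((\<eta> * n / 2) * (\<eta> * n / 2)) = \<kappa> * n * n"
        by (simp add: \<kappa>_def power2_eq_square)
      moreover have "5 * real n \<le> \<kappa> * n * n"
      proof (rule mult_right_mono)
        show "5 \<le> \<kappa> * n" using n(3) pos by (simp add: pos_divide_le_eq mult.commute)
      qed simp
      ultimately have "5 * real n \<le> \<rho> / 4 * real (d * d)" by linarith
      then have "exp (- (\<rho> / 4 * real (d * d))) \<le> exp (- (5 * real n))"
        by (simp only: exp_le_cancel_iff neg_le_iff_le)
      then have "4 ^ n * exp (- (\<rho> / 4 * real (d * d))) \<le> exp (4 * n) * exp (- (5 * real n))"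
        using four by (intro mult_mono) auto
      also have "\<dots> = exp (- real n)" by (simp flip: exp_add)
      finally show ?thesis by simp
    qed
    also have "\<dots> \<le> 8 / (real n)\<^sup>2"
      using power_mult_exp_le[of 1 "real n" 2] n1 by (simp add: field_simps)
    also have "\<dots> \<le> max (N\<^sup>2) 8 / (real n)\<^sup>2" by (intro divide_right_mono) auto
    finally show ?thesis .
  qed
  then show ?thesis by blast
qed

theorem mainTheorem2:
  shows "\<exists>C::real. \<forall>n::nat. \<forall>p::real. n \<ge> 1 \<and> 0 \<le> p \<and> p \<le> 1 - 10^5 / real n \<longrightarrow>
           gnp_prob n p (\<lambda>E. even_non_dec E {0..<n}) \<le> C / (real n)^2"
proof -
  obtain C0 where C0: "\<And>n p. n \<ge> 1 \<Longrightarrow> 1 / 2000 \<le> p \<Longrightarrow> p \<le> 1 - 1 / 2000 \<Longrightarrow>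
      gnp_prob n p (\<lambda>E. even_non_dec E {0..<n}) \<le> C0 / (real n)\<^sup>2"
    using gnp_prob_middle by blast
  \<comment> \<open>Both terms are values of \<open>power_mult_exp_le\<close>; the factor
    \<open>n\<close> in the degree bound raises the exponent from 2 to 3.\<close>
  define C1 :: real where "C1 = 20\<^sup>2 + 2 * (3 / (3 / 4000)) ^ 3"
  define C where "C = max C0 (max C1 (10 ^ 30))"
  have "gnp_prob n p (\<lambda>E. even_non_dec E {0..<n}) \<le> C / (real n)\<^sup>2"
    if n1: "n \<ge> 1" and p0: "0 \<le> p" and pn: "p \<le> 1 - 10 ^ 5 / real n" for n :: nat and p :: real
  proof -
    have "0 \<le> 1 - 10 ^ 5 / real n" using p0 pn by linarith
    \<comment> \<open>A probability in the given range exists only for such \<open>n\<close>, so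
      small \<open>n\<close> do not arise.\<close>
    then have rn: "real n \<ge> 10 ^ 5" using n1 by (simp add: field_simps)
    then have n: "n \<ge> 10 ^ 5" by simp
    have "0 \<le> 10 ^ 5 / real n" by simp
    then have p1: "p \<le> 1" using pn by linarith
    have extreme: ?thesis if "10 ^ 5 / n \<le> pair_prob p Q" "pair_prob p Q \<le> 1 / 2000" for Q
    proof -
      have "(real n)\<^sup>2 * exp (- (n / 10)) \<le> 20\<^sup>2" using power_mult_exp_le[of "1 / 10" "real n" 2] by simp
      moreover have "(real n) ^ 3 * exp (- (3 / 4000 * n)) \<le> (3 / (3 / 4000)) ^ 3"
        using power_mult_exp_le[of "3 / 4000" "real n" 3] by simp
      ultimately have "(exp (- (n / 10)) + 2 * n * exp (- (3 / 4000 * n))) * (real n)\<^sup>2 \<le> C1"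
        unfolding C1_def by (simp add: algebra_simps power2_eq_square power3_eq_cube)
      then have "exp (- (n / 10)) + 2 * n * exp (- (3 / 4000 * n)) \<le> C1 / (real n)\<^sup>2"
        using n1 by (simp add: pos_le_divide_eq)
      also have "\<dots> \<le> C / (real n)\<^sup>2" unfolding C_def by (intro divide_right_mono) auto
      finally show ?thesis using gnp_prob_sparse_or_dense[OF n p0 p1 that] by linarith
    qed
    consider "p < 10 ^ 5 / n" | "10 ^ 5 / n \<le> p" "p \<le> 1 / 2000" | "1 - p \<le> 1 / 2000"
      | "1 / 2000 \<le> p" "p \<le> 1 - 1 / 2000" by linarith
    then show ?thesis
    proof cases
      case 1
      have "gnp_prob n p (\<lambda>E. even_non_dec E {0..<n}) \<le> real n ^ 4 * p ^ 6" by (rule gnp_K4[OF p0 p1])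
      also have "\<dots> \<le> real n ^ 4 * (10 ^ 5 / n) ^ 6" using 1 p0 by (intro mult_left_mono power_mono) auto
      also have "\<dots> = 10 ^ 30 / (real n)\<^sup>2" using n1 by (simp add: field_simps flip: power_add)
      also have "\<dots> \<le> C / (real n)\<^sup>2" unfolding C_def by (intro divide_right_mono) auto
      finally show ?thesis .
    next
      case 2
      then show ?thesis using extreme[of True] by simp
    next
      case 3
      \<comment> \<open>Here \<open>pn\<close> bounds the probability of a non-edge from
        below.\<close>
      then show ?thesis using extreme[of False] pn by simp
    next
      case 4
      have "C0 / (real n)\<^sup>2 \<le> C / (real n)\<^sup>2" unfolding C_def by (intro divide_right_mono) auto
      then show ?thesis using C0[OF n1 4] by linarith
    qed
  qed
  then show ?thesis by blast
qed

end
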